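(* Let $(X,\mu,\mathcal{E},\mathcal{F})$ be a symmetric Dirichlet space with conservative semigroup. Assume that $\mathcal{E}$ is regular and irreducible. For $p\ge1$ let $\alpha_p^*(X)=\inf\{\alpha>0:\mathbf{B}^{p,\alpha}(X)\text{ is trivial}\}$. Then: (1) $\alpha_2^*(X)=\frac12$; (2) the map $p\mapsto\alpha_p^*(X)$ is non-increasing; (3) for $p\ge2$, $\alpha_p^*(X)\le\frac12$; (4) for $1\le p\le2$, $\frac12\le\alpha_p^*(X)\le\frac1p$.
   Context: $X$ is a topological space equipped with a Radon measure $\mu$; $\mathcal{E}$ is a symmetric Dirichlet form (closed Markovian symmetric bilinear form) on $L^2(X,\mu)$ with domain $\mathcal{F}$. $\{P_t\}_{t\ge0}$ is the associated Markovian semigroup, extended to a positive contraction semigroup on every $L^p(X,\mu)$. Conservative means $P_t1=1$. Regular: $\mathcal{F}\cap C_0(X)$ is dense in $\mathcal{F}$ for the domain norm and uniformly dense in $C_0(X)$. Irreducible: $f\in\mathcal{F}$ and $\mathcal{E}(f,f)=0$ imply that $f$ is constant. For $p\ge1$, $\alpha\ge0$ and $f\in L^p(X,\mu)$ define \[ \|f\|_{p,\alpha}=\sup_{t>0}t^{-\alpha}\left(\int_X P_t(|f-f(y)|^p)(y)\,d\mu(y)\right)^{1/p}; \] if $P_t$ has a heat kernel $p_t(x,y)$, the integral equals $\int_X\int_X|f(x)-f(y)|^pp_t(x,y)\,d\mu(x)\,d\mu(y)$. $\mathbf{B}^{p,\alpha}(X)=\{f\in L^p(X,\mu):\|f\|_{p,\alpha}<\infty\}$.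 The space $\mathbf{B}^{p,\alpha}(X)$ is called trivial if each of its elements is constant.
   Formalization: It is additionally assumed that L²(X,μ) contains a function that is not a.e. constant; otherwise (e.g. X a single point, E = 0, P_t = id) every B^{p,α}(X) is trivial, α_2^* = 0, and (1) and (4) fail. *)

theory Defs
  imports "HOL-Analysis.Analysis"
begin

text \<open>
  Elements of \<open>L\<^sup>p\<close> are represented by functions. Operators, forms and
  domains are therefore required to be compatible with equality almost everywhere.
\<close>

definition Lp :: "'a measure \<Rightarrow> real \<Rightarrow> ('a \<Rightarrow> real) set" where
  "Lp M p = {f \<in> borel_measurable M. integrable M (\<lambda>x. \<bar>f x\<bar> powr p)}"

definition L2_inner :: "'a measure \<Rightarrow> ('a \<Rightarrow> real) \<Rightarrow> ('a \<Rightarrow> real) \<Rightarrow> real" where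
  "L2_inner M f g = (LINT x|M. f x * g x)"

definition L2_norm :: "'a measure \<Rightarrow> ('a \<Rightarrow> real) \<Rightarrow> real" where
  "L2_norm M f = sqrt (L2_inner M f f)"

definition ae_constant :: "'a measure \<Rightarrow> ('a \<Rightarrow> real) \<Rightarrow> bool" where
  "ae_constant M f \<longleftrightarrow> (\<exists>c. AE x in M. f x = c)"

text \<open>
  Radon measures in the sense of Bourbaki and Schwartz: locally finite Borel measures that are
  inner regular with respect to compact sets. The condition \<open>K \<in> sets M\<close> is automatic
  in Hausdorff spaces.
\<close>

definition radon_measure :: "'a::topological_space measure \<Rightarrow> bool" where
  "radon_measure M \<longleftrightarrow>
     sets M = sets borel \<and>
     (\<forall>x. \<exists>U. open U \<and> x \<in> U \<and> emeasure M U < \<infinity>) \<and>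
     (\<forall>A\<in>sets M. emeasure M A = (SUP K\<in>{K. K \<subseteq> A \<and> compact K \<and> K \<in> sets M}. emeasure M K))"

definition domain_norm ::
    "'a measure \<Rightarrow> (('a \<Rightarrow> real) \<Rightarrow> ('a \<Rightarrow> real) \<Rightarrow> real) \<Rightarrow> ('a \<Rightarrow> real) \<Rightarrow> real" where
  "domain_norm M E f = sqrt (E f f + L2_inner M f f)"

text \<open>
  A densely defined, closed, Markovian, nonnegative symmetric bilinear form \<open>E\<close> with
  domain \<open>F\<close>. Values of \<open>E\<close> outside \<open>F\<close> are irrelevant.
\<close>

locale symmetric_dirichlet_form =
  fixes M :: "'a measure"
    and F :: "('a \<Rightarrow> real) set"
    and E :: "('a \<Rightarrow> real) \<Rightarrow> ('a \<Rightarrow> real) \<Rightarrow> real"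
  assumes domain_L2: "F \<subseteq> Lp M 2"
    and domain_zero: "(\<lambda>x. 0) \<in> F"
    and domain_add: "\<And>f g. f \<in> F \<Longrightarrow> g \<in> F \<Longrightarrow> (\<lambda>x. f x + g x) \<in> F"
    and domain_scale: "\<And>f c. f \<in> F \<Longrightarrow> (\<lambda>x. c * f x) \<in> F"
    and domain_AE: "\<And>f g. f \<in> F \<Longrightarrow> g \<in> borel_measurable M \<Longrightarrow> AE x in M. f x = g x \<Longrightarrow> g \<in> F"
    and domain_dense: "\<And>f e. f \<in> Lp M 2 \<Longrightarrow> e > 0 \<Longrightarrow> \<exists>g\<in>F. L2_norm M (\<lambda>x. f x - g x) < e"
    and form_add: "\<And>f g h. f \<in> F \<Longrightarrow> g \<in> F \<Longrightarrow> h \<in> F \<Longrightarrow> E (\<lambda>x. f x + g x) h = E f h + E g h"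
    and form_scale: "\<And>f h c. f \<in> F \<Longrightarrow> h \<in> F \<Longrightarrow> E (\<lambda>x. c * f x) h = c * E f h"
    and form_sym: "\<And>f g. f \<in> F \<Longrightarrow> g \<in> F \<Longrightarrow> E f g = E g f"
    and form_nonneg: "\<And>f. f \<in> F \<Longrightarrow> 0 \<le> E f f"
    and form_AE: "\<And>f g h. f \<in> F \<Longrightarrow> g \<in> F \<Longrightarrow> h \<in> F \<Longrightarrow> AE x in M. f x = g x \<Longrightarrow> E f h = E g h"
    and closed: "\<And>f. (\<And>n. f n \<in> F) \<Longrightarrow>
        (\<And>e. e > 0 \<Longrightarrow> \<exists>N::nat. \<forall>m\<ge>N. \<forall>n\<ge>N. domain_norm M E (\<lambda>x. f m x - f n x) < e) \<Longrightarrow>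
        \<exists>g\<in>F. (\<lambda>n. domain_norm M E (\<lambda>x. f n x - g x)) \<longlonglongrightarrow> 0"
    and markovian: "\<And>f. f \<in> F \<Longrightarrow> (\<lambda>x. min (max (f x) 0) 1) \<in> F \<and>
        E (\<lambda>x. min (max (f x) 0) 1) (\<lambda>x. min (max (f x) 0) 1) \<le> E f f"

text \<open>
  A strongly continuous, symmetric, Markovian contraction semigroup on \<open>L\<^sup>2\<close>.
\<close>

locale markovian_semigroup =
  fixes M :: "'a measure"
    and P :: "real \<Rightarrow> ('a \<Rightarrow> real) \<Rightarrow> ('a \<Rightarrow> real)"
  assumes maps_L2: "\<And>t f. t \<ge> 0 \<Longrightarrow> f \<in> Lp M 2 \<Longrightarrow> P t f \<in> Lp M 2"
    and AE_cong: "\<And>t f g. t \<ge> 0 \<Longrightarrow> f \<in> Lp M 2 \<Longrightarrow> g \<in> Lp M 2 \<Longrightarrow> AE x in M. f x = g x \<Longrightarrow>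
        AE x in M. P t f x = P t g x"
    and add: "\<And>t f g. t \<ge> 0 \<Longrightarrow> f \<in> Lp M 2 \<Longrightarrow> g \<in> Lp M 2 \<Longrightarrow>
        AE x in M. P t (\<lambda>y. f y + g y) x = P t f x + P t g x"
    and scale: "\<And>t f c. t \<ge> 0 \<Longrightarrow> f \<in> Lp M 2 \<Longrightarrow> AE x in M. P t (\<lambda>y. c * f y) x = c * P t f x"
    and zero: "\<And>f. f \<in> Lp M 2 \<Longrightarrow> AE x in M. P 0 f x = f x"
    and semigroup: "\<And>s t f. s \<ge> 0 \<Longrightarrow> t \<ge> 0 \<Longrightarrow> f \<in> Lp M 2 \<Longrightarrow>
        AE x in M. P (s + t) f x = P s (P t f) x"
    and contraction: "\<And>t f. t \<ge> 0 \<Longrightarrow> f \<in> Lp M 2 \<Longrightarrow> L2_norm M (P t f) \<le> L2_norm M f"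
    and symmetric: "\<And>t f g. t \<ge> 0 \<Longrightarrow> f \<in> Lp M 2 \<Longrightarrow> g \<in> Lp M 2 \<Longrightarrow>
        L2_inner M (P t f) g = L2_inner M f (P t g)"
    and strongly_continuous: "\<And>f. f \<in> Lp M 2 \<Longrightarrow>
        ((\<lambda>t. L2_norm M (\<lambda>x. P t f x - f x)) \<longlongrightarrow> 0) (at_right 0)"
    and markovian: "\<And>t f. t \<ge> 0 \<Longrightarrow> f \<in> Lp M 2 \<Longrightarrow> AE x in M. 0 \<le> f x \<and> f x \<le> 1 \<Longrightarrow>
        AE x in M. 0 \<le> P t f x \<and> P t f x \<le> 1"

text \<open>
  The semigroup is the one associated with the form: its infinitesimal generator \<open>A\<close>
  (left-hand side, \<open>A u = w\<close>) is the self-adjoint operator of the form, that is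
  \<open>E(u, v) = - \<langle>A u, v\<rangle>\<close> for all \<open>v \<in> F\<close>.
\<close>

definition associated_semigroup ::
    "'a measure \<Rightarrow> ('a \<Rightarrow> real) set \<Rightarrow> (('a \<Rightarrow> real) \<Rightarrow> ('a \<Rightarrow> real) \<Rightarrow> real) \<Rightarrow>
     (real \<Rightarrow> ('a \<Rightarrow> real) \<Rightarrow> ('a \<Rightarrow> real)) \<Rightarrow> bool" where
  "associated_semigroup M F E P \<longleftrightarrow>
     (\<forall>u\<in>Lp M 2. \<forall>w\<in>Lp M 2.
        ((\<lambda>t. L2_norm M (\<lambda>x. (P t u x - u x) / t - w x)) \<longlongrightarrow> 0) (at_right 0) \<longleftrightarrow>
        u \<in> F \<and> (\<forall>v\<in>F. E u v = - L2_inner M w v))"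

definition Cc :: "('a::topological_space \<Rightarrow> real) set" where
  "Cc = {f. continuous_on UNIV f \<and> compact (closure {x. f x \<noteq> 0})}"

definition regular_form ::
    "'a::topological_space measure \<Rightarrow> ('a \<Rightarrow> real) set \<Rightarrow> (('a \<Rightarrow> real) \<Rightarrow> ('a \<Rightarrow> real) \<Rightarrow> real) \<Rightarrow> bool"
  where
  "regular_form M F E \<longleftrightarrow>
     (\<forall>f\<in>F. \<forall>e>0. \<exists>g\<in>F \<inter> Cc. domain_norm M E (\<lambda>x. f x - g x) < e) \<and>
     (\<forall>f\<in>Cc. \<forall>e>0. \<exists>g\<in>F \<inter> Cc. \<forall>x. \<bar>f x - g x\<bar> < e)"

definition irreducible_form ::
    "'a measure \<Rightarrow> ('a \<Rightarrow> real) set \<Rightarrow> (('a \<Rightarrow> real) \<Rightarrow> ('a \<Rightarrow> real) \<Rightarrow> real) \<Rightarrow> bool" where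
  "irreducible_form M F E \<longleftrightarrow> (\<forall>f\<in>F. E f f = 0 \<longrightarrow> ae_constant M f)"

text \<open>
  \<open>positive_ext M T h g\<close>: the function \<open>g\<close> is a version of \<open>T h\<close>, where the symmetric
  positivity preserving operator \<open>T\<close> on \<open>L\<^sup>2\<close> is extended by duality to nonnegative
  measurable functions. For nonnegative \<open>h\<close> in some \<open>L\<^sup>p\<close> with \<open>1 \<le> p \<le> \<infinity>\<close> this is the usual
  extension of the semigroup operators. It is needed on \<open>L\<^sup>1 + L\<^sup>\<infinity>\<close>, which is where
  \<open>\<bar>f - c\<bar>\<^sup>p\<close> lies for \<open>f \<in> L\<^sup>p\<close>.
\<close>

definition positive_ext ::
    "'a measure \<Rightarrow> (('a \<Rightarrow> real) \<Rightarrow> ('a \<Rightarrow> real)) \<Rightarrow> ('a \<Rightarrow> ennreal) \<Rightarrow> ('a \<Rightarrow> ennreal) \<Rightarrow> bool" where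
  "positive_ext M T h g \<longleftrightarrow>
     h \<in> borel_measurable M \<and> g \<in> borel_measurable M \<and>
     (\<forall>u\<in>Lp M 2. (AE x in M. 0 \<le> u x) \<longrightarrow>
        (\<integral>\<^sup>+x. g x * ennreal (u x) \<partial>M) = (\<integral>\<^sup>+x. h x * ennreal (T u x) \<partial>M))"

definition conservative :: "'a measure \<Rightarrow> (real \<Rightarrow> ('a \<Rightarrow> real) \<Rightarrow> ('a \<Rightarrow> real)) \<Rightarrow> bool" where
  "conservative M P \<longleftrightarrow> (\<forall>t\<ge>0. positive_ext M (P t) (\<lambda>_. 1) (\<lambda>_. 1))"

text \<open>
  For each fixed \<open>c\<close>, \<open>T (\<bar>f - c\<bar>\<^sup>p)\<close> is only defined up to null sets, so evaluating it at
  \<open>y\<close> with \<open>c = f y\<close> requires consistent versions. There is a family of versions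
  \<open>G y c\<close> of \<open>T (\<bar>f - c\<bar>\<^sup>p) (y)\<close> depending continuously on \<open>c\<close>, and it is
  unique outside a null set of points \<open>y\<close>. If \<open>T\<close> has a kernel \<open>k(y, dx)\<close>, then
  \<open>G y c = \<integral> \<bar>f x - c\<bar>\<^sup>p k(y, dx)\<close> for almost every \<open>y\<close> and all \<open>c\<close>, and the integral below
  is the double integral of \<open>\<bar>f x - f y\<bar>\<^sup>p\<close> against \<open>k(y, dx) \<mu>(dy)\<close>.
\<close>

definition continuous_version ::
    "'a measure \<Rightarrow> (('a \<Rightarrow> real) \<Rightarrow> ('a \<Rightarrow> real)) \<Rightarrow> real \<Rightarrow> ('a \<Rightarrow> real) \<Rightarrow> ('a \<Rightarrow> real \<Rightarrow> ennreal) \<Rightarrow> bool"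
  where
  "continuous_version M T p f G \<longleftrightarrow>
     (\<forall>c. positive_ext M T (\<lambda>x. ennreal (\<bar>f x - c\<bar> powr p)) (\<lambda>y. G y c)) \<and>
     (\<forall>y. continuous_on UNIV (G y))"

definition increment_integral ::
    "'a measure \<Rightarrow> (('a \<Rightarrow> real) \<Rightarrow> ('a \<Rightarrow> real)) \<Rightarrow> real \<Rightarrow> ('a \<Rightarrow> real) \<Rightarrow> ennreal" where
  "increment_integral M T p f =
     (let G = (SOME G. continuous_version M T p f G) in \<integral>\<^sup>+y. G y (f y) \<partial>M)"

definition ennreal_root :: "real \<Rightarrow> ennreal \<Rightarrow> ennreal" where
  "ennreal_root p a = (if a = \<infinity> then \<infinity> else ennreal (enn2real a powr (1 / p)))"

definition besov_seminorm ::
    "'a measure \<Rightarrow> (real \<Rightarrow> ('a \<Rightarrow> real) \<Rightarrow> ('a \<Rightarrow> real)) \<Rightarrow> real \<Rightarrow> real \<Rightarrow> ('a \<Rightarrow> real) \<Rightarrow> ennreal" where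
  "besov_seminorm M P p \<alpha> f =
     (SUP t\<in>{0<..}. ennreal (t powr (- \<alpha>)) * ennreal_root p (increment_integral M (P t) p f))"

definition besov_space ::
    "'a measure \<Rightarrow> (real \<Rightarrow> ('a \<Rightarrow> real) \<Rightarrow> ('a \<Rightarrow> real)) \<Rightarrow> real \<Rightarrow> real \<Rightarrow> ('a \<Rightarrow> real) set" where
  "besov_space M P p \<alpha> = {f \<in> Lp M p. besov_seminorm M P p \<alpha> f < \<infinity>}"

definition besov_trivial ::
    "'a measure \<Rightarrow> (real \<Rightarrow> ('a \<Rightarrow> real) \<Rightarrow> ('a \<Rightarrow> real)) \<Rightarrow> real \<Rightarrow> real \<Rightarrow> bool" where
  "besov_trivial M P p \<alpha> \<longleftrightarrow> (\<forall>f\<in>besov_space M P p \<alpha>. ae_constant M f)"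

text \<open>Extended-real valued, so that the infimum of the empty set is \<open>\<infinity>\<close>.\<close>

definition critical_exponent ::
    "'a measure \<Rightarrow> (real \<Rightarrow> ('a \<Rightarrow> real) \<Rightarrow> ('a \<Rightarrow> real)) \<Rightarrow> real \<Rightarrow> ereal" where
  "critical_exponent M P p = Inf (ereal ` {\<alpha>. 0 < \<alpha> \<and> besov_trivial M P p \<alpha>})"

end

theory Submission
  imports Defs
begin

text \<open>
  For \<open>f \<in> L\<^sup>2\<close> the increment integral is \<open>2 \<langle>f - P\<^sub>t f, f\<rangle>\<close>, and the energy
  \<open>\<psi>(t) = \<langle>f - P\<^sub>t f, f\<rangle>\<close> satisfies \<open>2 \<psi>(t) - \<psi>(2t) = \<parallel>P\<^sub>t f - f\<parallel>\<^sup>2\<close>. Hence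
  \<open>\<psi>(t) \<le> 2\<^sup>n \<psi>(t/2\<^sup>n)\<close>: an energy of order \<open>t\<^sup>\<beta>\<close> with \<open>\<beta> > 1\<close> vanishes, so that \<open>f\<close> is fixed by
  the semigroup and constant by irreducibility, while \<open>\<psi>(t) \<le> C t\<close> on the domain of the generator,
  which contains a nonconstant function. This settles \<open>p = 2\<close>. For other exponents, increments are
  compared pointwise: for \<open>p \<le> q\<close> the excesses \<open>(\<plusminus>f - c)\<^sup>+\<close> of \<open>f \<in> B\<^sup>q\<^sup>,\<^sup>\<alpha>\<close> lie in
  \<open>B\<^sup>p\<^sup>,\<^sup>\<alpha>\<close> since they live on sets of finite measure, and for \<open>p \<le> 2\<close> the truncations of
  \<open>f \<in> B\<^sup>p\<^sup>,\<^sup>\<alpha>\<close> lie in \<open>B\<^sup>2\<^sup>,\<^sup>\<beta>\<close> with \<open>\<beta> = p \<alpha> / 2\<close>.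

  No kernel of \<open>P\<^sub>t\<close> is available. Pointwise inequalities are transported through \<open>P\<^sub>t\<close> for every
  rational \<open>c\<close> and almost every \<open>y\<close>, and extended by continuity to \<open>c = f y\<close>.
\<close>

section \<open>Square-integrable functions\<close>

text \<open>The increment integral is a \<open>p\<close>-th power, so belonging to the space with
  exponents \<open>p\<close> and \<open>\<alpha>\<close> means an increment bound of order
  \<open>t powr (p * \<alpha>)\<close>. At \<open>p = 2\<close> the decisive order is linear,
  \<open>2 * \<alpha> = 1\<close>, whence the value 1/2. Truncation trades
  \<open>(p, \<alpha>)\<close> for \<open>(2, p * \<alpha> / 2)\<close>, and the latter space is
  trivial once \<open>p * \<alpha> > 1\<close>, whence 1/p. The remaining bounds are monotonicity in
  \<open>p\<close>, read from \<open>p = 2\<close>.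

  Excesses enter because over an infinite measure a function in the larger \<open>L\<^sup>q\<close>
  need not lie in \<open>L\<^sup>p\<close>.

  Form and semigroup are linked through the generator alone. The nonconstant function of linear
  energy is therefore sought in the range of the resolvent, which lies in the domain of the
  generator, and not just anywhere in \<open>F\<close>.

  The duality extension handles values in \<open>[0, \<infinity>]\<close>, where subtraction is
  unreliable. Identities are thus stated between sums of nonnegative terms, and a term is cancelled
  only after it is known to be finite.\<close>

lemma Lp_measurable: "f \<in> Lp M p \<Longrightarrow> f \<in> borel_measurable M"
  by (simp add: Lp_def)

lemma Lp_2_iff: "f \<in> Lp M 2 \<longleftrightarrow> f \<in> borel_measurable M \<and> integrable M (\<lambda>x. f x * f x)"
  by (simp add: Lp_def power2_eq_square)

lemma L2_mult_integrable:
  assumes "f \<in> Lp M 2" "g \<in> Lp M 2"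
  shows "integrable M (\<lambda>x. f x * g x)"
proof (rule Bochner_Integration.integrable_bound)
  show "integrable M (\<lambda>x. f x * f x + g x * g x)"
    using assms by (simp add: Lp_2_iff)
  show "(\<lambda>x. f x * g x) \<in> borel_measurable M"
    using assms by (auto simp: Lp_2_iff)
  have "\<bar>a * b\<bar> \<le> \<bar>a * a + b * b\<bar>" for a b :: real
  proof -
    have "0 \<le> (\<bar>a\<bar> - \<bar>b\<bar>)\<^sup>2" "0 \<le> \<bar>a\<bar> * \<bar>b\<bar>" by simp_all
    then have "2 * (\<bar>a\<bar> * \<bar>b\<bar>) \<le> a * a + b * b"
      unfolding power2_eq_square by (simp add: algebra_simps)
    then have "\<bar>a * b\<bar> \<le> a * a + b * b"
      unfolding abs_mult using \<open>0 \<le> \<bar>a\<bar> * \<bar>b\<bar>\<close> by linarith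
    then show ?thesis by linarith
  qed
  then show "AE x in M. norm (f x * g x) \<le> norm (f x * f x + g x * g x)"
    by simp
qed

lemma L2_bound:
  assumes "f \<in> Lp M 2" "g \<in> borel_measurable M" "\<And>x. \<bar>g x\<bar> \<le> \<bar>f x\<bar>"
  shows "g \<in> Lp M 2"
proof -
  have "integrable M (\<lambda>x. g x * g x)"
  proof (rule Bochner_Integration.integrable_bound)
    show "integrable M (\<lambda>x. f x * f x)"
      using assms by (simp add: Lp_2_iff)
    show "AE x in M. norm (g x * g x) \<le> norm (f x * f x)"
      using assms(3) by (auto intro!: AE_I2 mult_mono simp: abs_mult simp del: abs_mult_self_eq)
  qed (use assms in simp)
  then show ?thesis
    using assms by (simp add: Lp_2_iff)
qed

lemma L2_add:
  assumes "f \<in> Lp M 2" "g \<in> Lp M 2"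
  shows "(\<lambda>x. f x + g x) \<in> Lp M 2"
proof -
  have "integrable M (\<lambda>x. f x * f x + 2 * (f x * g x) + g x * g x)"
    using assms L2_mult_integrable[OF assms] by (simp add: Lp_2_iff)
  moreover have "(\<lambda>x. f x * f x + 2 * (f x * g x) + g x * g x) = (\<lambda>x. (f x + g x) * (f x + g x))"
    by (auto simp: algebra_simps)
  ultimately show ?thesis
    using assms by (auto simp: Lp_2_iff)
qed

lemma L2_scale:
  assumes "f \<in> Lp M 2"
  shows "(\<lambda>x. c * f x) \<in> Lp M 2"
proof -
  have "integrable M (\<lambda>x. (c * c) * (f x * f x))"
    using assms by (simp add: Lp_2_iff)
  moreover have "(\<lambda>x. (c * c) * (f x * f x)) = (\<lambda>x. (c * f x) * (c * f x))"
    by (auto simp: algebra_simps)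
  ultimately show ?thesis
    using assms by (auto simp: Lp_2_iff)
qed

lemma L2_diff:
  assumes "f \<in> Lp M 2" "g \<in> Lp M 2"
  shows "(\<lambda>x. f x - g x) \<in> Lp M 2"
  using L2_add[OF assms(1) L2_scale[OF assms(2), of "-1"]] by simp

lemma L2_zero: "(\<lambda>x. 0) \<in> Lp M 2"
  by (simp add: Lp_2_iff)

lemma L2_indicator:
  assumes "A \<in> sets M" "emeasure M A < \<infinity>"
  shows "indicator A \<in> Lp M 2"
proof -
  have "(\<lambda>x. indicator A x * indicator A x) = (indicator A :: _ \<Rightarrow> real)"
    by (auto simp: indicator_def)
  then show ?thesis
    using assms by (simp add: Lp_2_iff)
qed

text \<open>Markov's inequality. It supplies the sets of finite measure on which all truncations and
  cutoffs below live.\<close>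

lemma Lp_superlevel_finite:
  assumes "f \<in> Lp M p" "e > 0" "p \<ge> 0"
  shows "emeasure M {x\<in>space M. \<bar>f x\<bar> \<ge> e} < \<infinity>"
proof -
  have [measurable]: "f \<in> borel_measurable M" using assms by (simp add: Lp_def)
  let ?A = "{x\<in>space M. \<bar>f x\<bar> \<ge> e}"
  have "integrable M (indicator ?A :: _ \<Rightarrow> real)"
  proof (rule Bochner_Integration.integrable_bound)
    show "integrable M (\<lambda>x. \<bar>f x\<bar> powr p / e powr p)"
      using assms by (simp add: Lp_def)
    show "AE x in M. norm (indicator ?A x :: real) \<le> norm (\<bar>f x\<bar> powr p / e powr p)"
      using assms by (auto simp: indicator_def intro!: powr_mono2)
  qed simp
  then show ?thesis by (simp add: integrable_indicator_iff)
qed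

lemma L2_bounded_on_finite:
  assumes "A \<in> sets M" "emeasure M A < \<infinity>" "g \<in> borel_measurable M"
    "\<And>x. x \<in> space M \<Longrightarrow> \<bar>g x\<bar> \<le> B * indicator A x"
  shows "g \<in> Lp M 2"
proof -
  have "(\<lambda>x. B * indicator A x) \<in> Lp M 2"
    using L2_scale[OF L2_indicator[OF assms(1,2)]] .
  have "integrable M (\<lambda>x. g x * g x)"
  proof (rule Bochner_Integration.integrable_bound)
    show "integrable M (\<lambda>x. (B * indicator A x) * (B * indicator A x))"
      using \<open>_ \<in> Lp M 2\<close> by (simp only: Lp_2_iff)
    have "\<bar>g x\<bar> * \<bar>g x\<bar> \<le> \<bar>B * indicator A x\<bar> * \<bar>B * indicator A x\<bar>" if "x \<in> space M" for x
      using assms(4)[OF that] by (intro mult_mono) auto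
    then show "AE x in M. norm (g x * g x) \<le> norm ((B * indicator A x) * (B * indicator A x))"
      by (simp only: real_norm_def abs_mult) simp
  qed (use assms in simp)
  then show ?thesis using assms by (simp add: Lp_2_iff)
qed

section \<open>Extension of a conservative operator to nonnegative functions\<close>

text \<open>
  Semifiniteness replaces \<open>\<sigma>\<close>-finiteness, which a Radon measure may lack; it makes the
  extension of an operator to nonnegative functions unique almost everywhere.
\<close>

locale conservative_operator =
  fixes M :: "'a measure" and T :: "('a \<Rightarrow> real) \<Rightarrow> 'a \<Rightarrow> real"
  assumes semifinite: "\<And>A. A \<in> sets M \<Longrightarrow> emeasure M A \<noteq> 0 \<Longrightarrow>
      \<exists>B\<in>sets M. B \<subseteq> A \<and> emeasure M B \<noteq> 0 \<and> emeasure M B < \<infinity>"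
    and L2: "\<And>f. f \<in> Lp M 2 \<Longrightarrow> T f \<in> Lp M 2"
    and add: "\<And>f g. f \<in> Lp M 2 \<Longrightarrow> g \<in> Lp M 2 \<Longrightarrow> AE x in M. T (\<lambda>y. f y + g y) x = T f x + T g x"
    and scale: "\<And>f c. f \<in> Lp M 2 \<Longrightarrow> AE x in M. T (\<lambda>y. c * f y) x = c * T f x"
    and symmetric: "\<And>f g. f \<in> Lp M 2 \<Longrightarrow> g \<in> Lp M 2 \<Longrightarrow> L2_inner M (T f) g = L2_inner M f (T g)"
    and markovian: "\<And>f. f \<in> Lp M 2 \<Longrightarrow> AE x in M. 0 \<le> f x \<and> f x \<le> 1 \<Longrightarrow>
      AE x in M. 0 \<le> T f x \<and> T f x \<le> 1"
    and conservative: "positive_ext M T (\<lambda>_. 1) (\<lambda>_. 1)"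
begin

lemma measurable_T: "f \<in> Lp M 2 \<Longrightarrow> T f \<in> borel_measurable M"
  using L2 Lp_measurable by blast

text \<open>A set of positive measure contains one of finite positive measure, and indicators of
  finite-measure sets are legitimate \<open>L\<^sup>2\<close> test functions. This is how
  semifiniteness enters every almost-everywhere statement about extensions.\<close>

lemma AE_not_if_no_finite_subset:
  assumes "Measurable.pred M Q"
    "\<And>B. B \<in> sets M \<Longrightarrow> (\<And>x. x \<in> B \<Longrightarrow> Q x) \<Longrightarrow> emeasure M B < \<infinity> \<Longrightarrow> emeasure M B = 0"
  shows "AE x in M. \<not> Q x"
proof -
  have "emeasure M {x\<in>space M. Q x} = 0"
  proof (rule ccontr)
    assume "emeasure M {x\<in>space M. Q x} \<noteq> 0"
    then obtain B where "B \<in> sets M" "B \<subseteq> {x\<in>space M. Q x}" "emeasure M B \<noteq> 0" "emeasure M B < \<infinity>"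
      using semifinite[of "{x\<in>space M. Q x}"] assms(1) by (auto simp: pred_def)
    then show False using assms(2)[of B] by auto
  qed
  then show ?thesis
    using assms(1) by (subst AE_iff_measurable[where N="{x\<in>space M. Q x}"]) (auto simp: pred_def)
qed

text \<open>Where \<open>g' < g\<close>, two rationals \<open>q < r\<close> separate the values,
  even infinite ones. On a finite-measure set \<open>B\<close> with a fixed such pair, integration
  gives \<open>r * measure M B \<le> q * measure M B\<close>, so \<open>B\<close> is null; countably
  many pairs suffice.\<close>

lemma AE_le_if_integral_le:
  fixes g g' :: "'a \<Rightarrow> ennreal"
  assumes [measurable]: "g \<in> borel_measurable M" "g' \<in> borel_measurable M"
    and le: "\<And>B. B \<in> sets M \<Longrightarrow> emeasure M B < \<infinity> \<Longrightarrow>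
      (\<integral>\<^sup>+x. g x * indicator B x \<partial>M) \<le> (\<integral>\<^sup>+x. g' x * indicator B x \<partial>M)"
  shows "AE x in M. g x \<le> g' x"
proof -
  have "AE x in M. \<forall>q::rat. \<forall>r::rat. \<not> (0 \<le> real_of_rat q \<and> real_of_rat q < real_of_rat r \<and>
      g' x \<le> ennreal (real_of_rat q) \<and> ennreal (real_of_rat r) \<le> g x)"
    unfolding AE_all_countable
  proof (intro allI AE_not_if_no_finite_subset)
    fix q r :: rat and B
    let ?q = "real_of_rat q" and ?r = "real_of_rat r"
    assume B[measurable]: "B \<in> sets M" and fin: "emeasure M B < \<infinity>"
      and *: "\<And>x. x \<in> B \<Longrightarrow> 0 \<le> ?q \<and> ?q < ?r \<and> g' x \<le> ennreal ?q \<and> ennreal ?r \<le> g x"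
    show "emeasure M B = 0"
    proof (cases "B = {}")
      case False
      then have qr: "0 \<le> ?q" "?q < ?r" using * by auto
      have "ennreal ?r * emeasure M B = (\<integral>\<^sup>+x. ennreal ?r * indicator B x \<partial>M)"
        by (simp add: nn_integral_cmult_indicator)
      also have "\<dots> \<le> (\<integral>\<^sup>+x. g x * indicator B x \<partial>M)"
        using * by (intro nn_integral_mono) (auto simp: indicator_def)
      also have "\<dots> \<le> (\<integral>\<^sup>+x. g' x * indicator B x \<partial>M)"
        using le[OF B fin] .
      also have "\<dots> \<le> (\<integral>\<^sup>+x. ennreal ?q * indicator B x \<partial>M)"
        using * by (intro nn_integral_mono) (auto simp: indicator_def)
      also have "\<dots> = ennreal ?q * emeasure M B"
        by (simp add: nn_integral_cmult_indicator)
      finally have "ennreal ?r * ennreal (measure M B) \<le> ennreal ?q * ennreal (measure M B)"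
        using fin by (simp add: emeasure_eq_ennreal_measure)
      moreover have "0 \<le> ?r" using qr by linarith
      ultimately have "ennreal (?r * measure M B) \<le> ennreal (?q * measure M B)"
        using qr by (simp only: ennreal_mult measure_nonneg)
      then have "?r * measure M B \<le> ?q * measure M B"
        using qr(1) by (subst (asm) ennreal_le_iff) auto
      then have "(?r - ?q) * measure M B \<le> 0"
        by (simp add: left_diff_distrib)
      then have "measure M B \<le> 0" using qr by (simp add: mult_le_0_iff)
      then show ?thesis using fin
        by (metis emeasure_eq_ennreal_measure ennreal_eq_0_iff infinity_ennreal_def less_irrefl)
    qed simp
  qed measurable
  then show ?thesis
  proof eventually_elim
    case (elim x)
    show "g x \<le> g' x"
    proof (rule ccontr)
      assume "\<not> g x \<le> g' x"
      then have "g' x < g x" by simp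
      then obtain z where z: "g' x < z" "z < g x" using dense by blast
      then obtain a where a: "g' x < ennreal a" "ennreal a < g x" "0 \<le> a"
        by (cases z) auto
      obtain z' where z': "ennreal a < z'" "z' < g x" using a(2) dense by blast
      then obtain b where b: "ennreal a < ennreal b" "ennreal b < g x" "0 \<le> b"
        by (cases z') auto
      then have "a < b" using a by (simp add: ennreal_less_iff)
      obtain q where q: "a < real_of_rat q" "real_of_rat q < b"
        using of_rat_dense[OF \<open>a < b\<close>] by blast
      obtain r where r: "real_of_rat q < real_of_rat r" "real_of_rat r < b"
        using of_rat_dense[OF q(2)] by blast
      have "g' x \<le> ennreal (real_of_rat q)"
        using a(1) q(1) by (meson ennreal_leI less_imp_le order_trans)
      moreover have "ennreal (real_of_rat r) \<le> g x"
        using b(2) r(2) by (meson ennreal_leI less_imp_le order_trans)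
      moreover have "0 \<le> real_of_rat q" using a(3) q(1) by linarith
      ultimately show False using elim r(1) by blast
    qed
  qed
qed

lemma positive_ext_mono:
  assumes "positive_ext M T h g" "positive_ext M T h' g'" "AE x in M. h x \<le> h' x"
  shows "AE x in M. g x \<le> g' x"
proof (rule AE_le_if_integral_le)
  fix B assume B: "B \<in> sets M" "emeasure M B < \<infinity>"
  have ind: "indicator B \<in> Lp M 2" "AE x in M. 0 \<le> (indicator B x :: real)"
    using L2_indicator[OF B] by auto
  have "(\<integral>\<^sup>+x. g x * ennreal (indicator B x) \<partial>M) = (\<integral>\<^sup>+x. h x * ennreal (T (indicator B) x) \<partial>M)"
    using assms(1) ind by (auto simp: positive_ext_def)
  also have "\<dots> \<le> (\<integral>\<^sup>+x. h' x * ennreal (T (indicator B) x) \<partial>M)"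
    using assms(3) by (intro nn_integral_mono_AE) (auto elim!: eventually_mono intro: mult_right_mono)
  also have "\<dots> = (\<integral>\<^sup>+x. g' x * ennreal (indicator B x) \<partial>M)"
    using assms(2) ind by (auto simp: positive_ext_def)
  finally show "(\<integral>\<^sup>+x. g x * indicator B x \<partial>M) \<le> (\<integral>\<^sup>+x. g' x * indicator B x \<partial>M)"
    by (simp add: ennreal_indicator)
qed (use assms in \<open>auto simp: positive_ext_def\<close>)

lemma positive_ext_unique:
  assumes "positive_ext M T h g" "positive_ext M T h g'"
  shows "AE x in M. g x = g' x"
  using positive_ext_mono[OF assms] positive_ext_mono[OF assms(2,1)] by fastforce

lemma positive_ext_cong_AE:
  assumes "positive_ext M T h g" "AE x in M. g x = g' x" "g' \<in> borel_measurable M"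
  shows "positive_ext M T h g'"
proof -
  have "(\<integral>\<^sup>+x. g' x * ennreal (u x) \<partial>M) = (\<integral>\<^sup>+x. g x * ennreal (u x) \<partial>M)" for u
    using assms(2) by (intro nn_integral_cong_AE) auto
  then show ?thesis using assms by (auto simp: positive_ext_def)
qed

lemma positive_ext_add:
  assumes "positive_ext M T h g" "positive_ext M T h' g'"
  shows "positive_ext M T (\<lambda>x. h x + h' x) (\<lambda>x. g x + g' x)"
  unfolding positive_ext_def
proof (intro conjI ballI impI)
  have [measurable]: "h \<in> borel_measurable M" "h' \<in> borel_measurable M" "g \<in> borel_measurable M"
      "g' \<in> borel_measurable M"
    using assms by (auto simp: positive_ext_def)
  show "(\<lambda>x. h x + h' x) \<in> borel_measurable M" "(\<lambda>x. g x + g' x) \<in> borel_measurable M"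
    by measurable
  fix u assume u: "u \<in> Lp M 2" "AE x in M. 0 \<le> u x"
  have [measurable]: "u \<in> borel_measurable M" "T u \<in> borel_measurable M"
    using u measurable_T Lp_measurable by blast+
  show "(\<integral>\<^sup>+x. (g x + g' x) * ennreal (u x) \<partial>M) = (\<integral>\<^sup>+x. (h x + h' x) * ennreal (T u x) \<partial>M)"
    using assms u by (simp add: positive_ext_def distrib_right nn_integral_add)
qed

lemma positive_ext_cmult:
  assumes "positive_ext M T h g"
  shows "positive_ext M T (\<lambda>x. c * h x) (\<lambda>x. c * g x)"
  unfolding positive_ext_def
proof (intro conjI ballI impI)
  have [measurable]: "h \<in> borel_measurable M" "g \<in> borel_measurable M"
    using assms by (auto simp: positive_ext_def)
  show "(\<lambda>x. c * h x) \<in> borel_measurable M" "(\<lambda>x. c * g x) \<in> borel_measurable M"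
    by measurable
  fix u assume u: "u \<in> Lp M 2" "AE x in M. 0 \<le> u x"
  have [measurable]: "u \<in> borel_measurable M" "T u \<in> borel_measurable M"
    using u measurable_T Lp_measurable by blast+
  show "(\<integral>\<^sup>+x. c * g x * ennreal (u x) \<partial>M) = (\<integral>\<^sup>+x. c * h x * ennreal (T u x) \<partial>M)"
    using assms u by (simp add: positive_ext_def mult.assoc nn_integral_cmult)
qed

lemma positive_ext_const: "positive_ext M T (\<lambda>_. c) (\<lambda>_. c)"
  using positive_ext_cmult[OF conservative, of c] by simp

text \<open>The Markov property speaks of functions with values in [0, 1] only. An unbounded
  \<open>u\<close> is reached by symmetry: on a set \<open>B\<close> where \<open>T u < 0\<close>,
  the integral of \<open>T u\<close> equals the pairing of \<open>u\<close> with
  \<open>T (indicator B)\<close>, which is nonnegative.\<close>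

lemma T_nonneg:
  assumes u: "u \<in> Lp M 2" "AE x in M. 0 \<le> u x"
  shows "AE x in M. 0 \<le> T u x"
proof -
  have [measurable]: "T u \<in> borel_measurable M"
    using u measurable_T by blast
  have "AE x in M. \<not> (T u x < 0)"
  proof (rule AE_not_if_no_finite_subset)
    fix B assume B[measurable]: "B \<in> sets M" and neg: "\<And>x. x \<in> B \<Longrightarrow> T u x < 0" and "emeasure M B < \<infinity>"
    have iB: "indicator B \<in> Lp M 2" using L2_indicator[OF B \<open>emeasure M B < \<infinity>\<close>] .
    have "AE x in M. 0 \<le> T (indicator B) x \<and> T (indicator B) x \<le> 1"
      by (rule markovian[OF iB]) (simp add: indicator_def)
    then have "0 \<le> L2_inner M u (T (indicator B))"
      unfolding L2_inner_def using u(2) by (intro integral_nonneg_AE) auto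
    then have "0 \<le> (LINT x|M. T u x * indicator B x)"
      using symmetric[OF u(1) iB] by (simp add: L2_inner_def)
    moreover have int: "integrable M (\<lambda>x. T u x * indicator B x)"
      using L2_mult_integrable[OF L2[OF u(1)] iB] .
    have np: "AE x in M. 0 \<le> - (T u x * indicator B x)"
      using neg by (intro AE_I2) (force simp: indicator_def)
    moreover have "0 \<le> (LINT x|M. - (T u x * indicator B x))"
      using np by (rule integral_nonneg_AE)
    ultimately have "(LINT x|M. - (T u x * indicator B x)) = 0" by simp
    then have "AE x in M. - (T u x * indicator B x) = 0"
      using integral_nonneg_eq_0_iff_AE[OF _ np] int by simp
    then have "AE x in M. x \<notin> B"
      by (auto elim!: eventually_mono dest: neg)
    then show "emeasure M B = 0"
      by (subst (asm) AE_iff_measurable[OF B]) (use sets.sets_into_space[OF B] in auto)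
  qed measurable
  then show ?thesis by (auto elim: eventually_mono)
qed

lemma T_mono:
  assumes "u \<in> Lp M 2" "v \<in> Lp M 2" "AE x in M. u x \<le> v x"
  shows "AE x in M. T u x \<le> T v x"
proof -
  have d: "(\<lambda>x. v x - u x) \<in> Lp M 2" by (rule L2_diff[OF assms(2,1)])
  have "AE x in M. 0 \<le> T (\<lambda>x. v x - u x) x"
    using assms(3) by (intro T_nonneg d) auto
  moreover have "AE x in M. T v x = T u x + T (\<lambda>x. v x - u x) x"
    using add[OF assms(1) d] by simp
  ultimately show ?thesis by eventually_elim simp
qed

lemma nn_integral_L2_mult:
  assumes "u \<in> Lp M 2" "v \<in> Lp M 2" "AE x in M. 0 \<le> u x" "AE x in M. 0 \<le> v x"
  shows "(\<integral>\<^sup>+x. ennreal (u x) * ennreal (v x) \<partial>M) = ennreal (L2_inner M u v)"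
proof -
  have "(\<integral>\<^sup>+x. ennreal (u x) * ennreal (v x) \<partial>M) = (\<integral>\<^sup>+x. ennreal (u x * v x) \<partial>M)"
    using assms(3,4) by (intro nn_integral_cong_AE) (auto simp: ennreal_mult)
  also have "\<dots> = ennreal (LINT x|M. u x * v x)"
    using assms(3,4) L2_mult_integrable[OF assms(1,2)] by (intro nn_integral_eq_integral) auto
  finally show ?thesis by (simp add: L2_inner_def)
qed

lemma positive_ext_L2:
  assumes "u \<in> Lp M 2" "AE x in M. 0 \<le> u x"
  shows "positive_ext M T (\<lambda>x. ennreal (u x)) (\<lambda>x. ennreal (T u x))"
  unfolding positive_ext_def
  using assms Lp_measurable[OF assms(1)] measurable_T[OF assms(1)] symmetric[OF assms(1)]
    nn_integral_L2_mult T_nonneg L2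
  by (simp add: measurable_compose[OF _ measurable_ennreal])

text \<open>Conservativeness is stated by duality, so testing it on \<open>u\<close> is exactly
  preservation of mass.\<close>

lemma nn_integral_T:
  assumes "u \<in> Lp M 2" "AE x in M. 0 \<le> u x"
  shows "(\<integral>\<^sup>+x. ennreal (T u x) \<partial>M) = (\<integral>\<^sup>+x. ennreal (u x) \<partial>M)"
  using conservative assms by (simp add: positive_ext_def)

lemma T_incseq:
  assumes "\<And>n. u n \<in> Lp M 2" "\<And>n x. u n x \<le> u (Suc n) x"
  shows "AE x in M. \<forall>n. ennreal (T (u n) x) \<le> ennreal (T (u (Suc n)) x)"
  unfolding AE_all_countable
proof
  fix n
  have "AE x in M. T (u n) x \<le> T (u (Suc n)) x"
    by (rule T_mono) (use assms in auto)
  then show "AE x in M. ennreal (T (u n) x) \<le> ennreal (T (u (Suc n)) x)"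
    by (auto elim: eventually_mono intro: ennreal_leI)
qed

text \<open>Monotone convergence on both sides of the duality identity. On the side of
  \<open>T\<close> the sequence increases only almost everywhere.\<close>

lemma positive_ext_SUP:
  assumes u: "\<And>n::nat. u n \<in> Lp M 2" "\<And>n x. 0 \<le> u n x" "\<And>n x. u n x \<le> u (Suc n) x"
  shows "positive_ext M T (\<lambda>x. SUP n. ennreal (u n x)) (\<lambda>x. SUP n. ennreal (T (u n) x))"
  unfolding positive_ext_def
proof (intro conjI ballI impI)
  have [measurable]: "u n \<in> borel_measurable M" "T (u n) \<in> borel_measurable M" for n
    using u(1) measurable_T Lp_measurable by blast+
  show "(\<lambda>x. SUP n. ennreal (u n x)) \<in> borel_measurable M" 
    "(\<lambda>x. SUP n. ennreal (T (u n) x)) \<in> borel_measurable M"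
    by measurable
  fix v assume v: "v \<in> Lp M 2" "AE x in M. 0 \<le> v x"
  have [measurable]: "v \<in> borel_measurable M" "T v \<in> borel_measurable M"
    using v measurable_T Lp_measurable by blast+
  have "(\<integral>\<^sup>+x. (SUP n. ennreal (T (u n) x)) * ennreal (v x) \<partial>M) =
      (\<integral>\<^sup>+x. (SUP n. ennreal (T (u n) x) * ennreal (v x)) \<partial>M)"
    by (simp add: SUP_mult_right_ennreal)
  also have "\<dots> = (SUP n. \<integral>\<^sup>+x. ennreal (T (u n) x) * ennreal (v x) \<partial>M)"
  proof (rule nn_integral_monotone_convergence_SUP_AE)
    fix n
    show "AE x in M. ennreal (T (u n) x) * ennreal (v x) \<le> ennreal (T (u (Suc n)) x) * ennreal (v x)"
      using T_incseq[of u, OF u(1,3)] by (auto elim!: eventually_mono intro: mult_right_mono)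
  qed measurable
  also have "\<dots> = (SUP n. \<integral>\<^sup>+x. ennreal (u n x) * ennreal (T v x) \<partial>M)"
    using positive_ext_L2[OF u(1)] u(2) v by (simp add: positive_ext_def)
  also have "\<dots> = (\<integral>\<^sup>+x. (SUP n. ennreal (u n x) * ennreal (T v x)) \<partial>M)"
    using u(3) by (intro nn_integral_monotone_convergence_SUP[symmetric])
      (auto simp: incseq_Suc_iff le_fun_def intro!: mult_right_mono ennreal_leI)
  also have "\<dots> = (\<integral>\<^sup>+x. (SUP n. ennreal (u n x)) * ennreal (T v x) \<partial>M)"
    by (simp add: SUP_mult_right_ennreal)
  finally show "(\<integral>\<^sup>+x. (SUP n. ennreal (T (u n) x)) * ennreal (v x) \<partial>M) =
      (\<integral>\<^sup>+x. (SUP n. ennreal (u n x)) * ennreal (T v x) \<partial>M)" .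
qed

lemma nn_integral_T_SUP:
  assumes u: "\<And>n::nat. u n \<in> Lp M 2" "\<And>n x. 0 \<le> u n x" "\<And>n x. u n x \<le> u (Suc n) x"
  shows "(\<integral>\<^sup>+x. (SUP n. ennreal (T (u n) x)) \<partial>M) = (\<integral>\<^sup>+x. (SUP n. ennreal (u n x)) \<partial>M)"
proof -
  have [measurable]: "u n \<in> borel_measurable M" "T (u n) \<in> borel_measurable M" for n
    using u(1) measurable_T Lp_measurable by blast+
  have "(\<integral>\<^sup>+x. (SUP n. ennreal (T (u n) x)) \<partial>M) = (SUP n. \<integral>\<^sup>+x. ennreal (T (u n) x) \<partial>M)"
    using T_incseq[of u, OF u(1,3)]
    by (intro nn_integral_monotone_convergence_SUP_AE) (auto elim: eventually_mono)
  also have "\<dots> = (SUP n. \<integral>\<^sup>+x. ennreal (u n x) \<partial>M)"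
    using nn_integral_T[OF u(1)] u(2) by simp
  also have "\<dots> = (\<integral>\<^sup>+x. (SUP n. ennreal (u n x)) \<partial>M)"
    using u(3) by (intro nn_integral_monotone_convergence_SUP[symmetric])
      (auto simp: incseq_Suc_iff le_fun_def intro!: ennreal_leI)
  finally show ?thesis .
qed

end

text \<open>Truncation in height and away from \<open>s = 0\<close> produces
  \<open>L\<^sup>2\<close> functions when \<open>s\<close> is the value of an \<open>Lp\<close>
  function. The zero set is lost in the limit, since it may have infinite measure; it is treated
  separately in \<open>positive_ext_exists\<close>.\<close>

lemma SUP_truncation:
  fixes s K :: real
  assumes "0 \<le> K"
  shows "(SUP n. ennreal (if 1 / real (Suc n) \<le> \<bar>s\<bar> then min K (real n) else 0)) = (if s \<noteq> 0 then ennreal K else 0)"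
proof -
  define t where "t n = (if 1 / real (Suc n) \<le> \<bar>s\<bar> then min K (real n) else 0)" for n
  have "(SUP n. ennreal (t n)) = (if s \<noteq> 0 then ennreal K else 0)"
  proof (cases "s = 0")
    case True
    have "0 < 1 / real (Suc n)" for n by simp
    then have "t n = 0" for n unfolding t_def True by (simp add: not_le)
    then show ?thesis using True by simp
  next
    case False
    then have "0 < \<bar>s\<bar>" by simp
    then obtain n1 where n1: "1 / real (Suc n1) < \<bar>s\<bar>" by (rule nat_approx_posE)
    obtain n2 where n2: "K \<le> real n2" using real_arch_simple by blast
    define n where "n = max n1 n2"
    have "1 / real (Suc n) \<le> 1 / real (Suc n1)"
      unfolding n_def by (intro divide_left_mono) auto
    then have "1 / real (Suc n) \<le> \<bar>s\<bar>" using n1 by linarith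
    moreover have "K \<le> real n" using n2 by (simp add: n_def)
    ultimately have "t n = K" unfolding t_def by (simp only: if_True min_absorb1)
    then have "ennreal K \<le> (SUP n. ennreal (t n))" by (intro SUP_upper2[of n]) auto
    moreover have "t n \<le> K" for n unfolding t_def using assms by (simp only: min.cobounded1 split: if_split) simp
    then have "(SUP n. ennreal (t n)) \<le> ennreal K" by (intro SUP_least ennreal_leI)
    ultimately show ?thesis using False by (simp add: antisym)
  qed
  then show ?thesis unfolding t_def .
qed

section \<open>Continuity in the parameter \<open>c\<close>: power inequalities and Lipschitz
  extension\<close>

lemma powr_diff_le:
  fixes a b R p :: real
  assumes "0 \<le> a" "a \<le> R" "0 \<le> b" "1 \<le> p"
  shows "a powr p \<le> b powr p + p * R powr (p - 1) * \<bar>a - b\<bar>"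
proof (cases "a \<le> b")
  case True
  then have "a powr p \<le> b powr p" using assms by (intro powr_mono2) auto
  then show ?thesis using assms by (smt (verit) mult_nonneg_nonneg powr_ge_zero)
next
  case False
  then have "b < a" by simp
  have "\<exists>l z. b < z \<and> z < a \<and> DERIV (\<lambda>x. x powr p) z :> l \<and> a powr p - b powr p = (a - b) * l"
  proof (rule MVT[OF \<open>b < a\<close>])
    show "continuous_on {b..a} (\<lambda>x. x powr p)"
      using assms by (intro continuous_on_powr' continuous_intros) auto
    show "(\<lambda>x. x powr p) differentiable (at x)" if "b < x" "x < a" for x
      using that assms has_real_derivative_powr[of x p] by (auto simp: real_differentiable_def)
  qed
  then obtain l z where z: "b < z" "z < a" "DERIV (\<lambda>x. x powr p) z :> l" "a powr p - b powr p = (a - b) * l"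
    by blast
  have "l = p * z powr (p - 1)"
    using z assms has_real_derivative_powr[of z p] DERIV_unique by fastforce
  moreover have "z powr (p - 1) \<le> R powr (p - 1)"
    using z assms by (intro powr_mono2) auto
  ultimately have "l \<le> p * R powr (p - 1)" using assms by simp
  then have "(a - b) * l \<le> (a - b) * (p * R powr (p - 1))"
    using \<open>b < a\<close> by (intro mult_left_mono) auto
  then show ?thesis using z(4) \<open>b < a\<close> by (simp add: algebra_simps)
qed

text \<open>
  Dividing by \<open>(1 + \<bar>c\<bar>)\<^sup>p\<close> makes \<open>c \<mapsto> \<bar>s - c\<bar>\<^sup>p\<close> globally Lipschitz, with a constant
  \<open>2 p (1 + \<bar>s\<bar>)\<^sup>p\<close> to which the operator can be applied.
\<close>

lemma normalized_powr_lipschitz: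
  fixes s c c' p :: real
  assumes "1 \<le> p"
  shows "\<bar>s - c\<bar> powr p / (1 + \<bar>c\<bar>) powr p \<le>
    \<bar>s - c'\<bar> powr p / (1 + \<bar>c'\<bar>) powr p + 2 * p * \<bar>c - c'\<bar> * (1 + \<bar>s\<bar>) powr p"
proof -
  define a where "a = \<bar>s - c\<bar> / (1 + \<bar>c\<bar>)"
  define b where "b = \<bar>s - c'\<bar> / (1 + \<bar>c'\<bar>)"
  have bound: "\<bar>s - d\<bar> / (1 + \<bar>d\<bar>) \<le> 1 + \<bar>s\<bar>" for d
  proof -
    have "\<bar>s - d\<bar> \<le> \<bar>s\<bar> + \<bar>d\<bar>" "0 \<le> \<bar>s\<bar> * \<bar>d\<bar>" by simp_all
    moreover have "(1 + \<bar>s\<bar>) * (1 + \<bar>d\<bar>) = 1 + \<bar>s\<bar> + \<bar>d\<bar> + \<bar>s\<bar> * \<bar>d\<bar>"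
      by (simp add: algebra_simps)
    ultimately have "\<bar>s - d\<bar> \<le> (1 + \<bar>s\<bar>) * (1 + \<bar>d\<bar>)" by linarith
    then show ?thesis by (simp add: divide_le_eq)
  qed
  have "a - b = (\<bar>s - c\<bar> - \<bar>s - c'\<bar>) / (1 + \<bar>c\<bar>) + b * ((\<bar>c'\<bar> - \<bar>c\<bar>) / (1 + \<bar>c\<bar>))"
  proof -
    have w: "1 + \<bar>c\<bar> \<noteq> 0" "1 + \<bar>c'\<bar> \<noteq> 0" by linarith+
    have "a - b = (\<bar>s - c\<bar> - b * (1 + \<bar>c\<bar>)) / (1 + \<bar>c\<bar>)"
      using w by (simp add: a_def diff_divide_distrib)
    also have "\<bar>s - c\<bar> - b * (1 + \<bar>c\<bar>) = (\<bar>s - c\<bar> - b * (1 + \<bar>c'\<bar>)) + b * (\<bar>c'\<bar> - \<bar>c\<bar>)"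
      by (simp add: algebra_simps)
    also have "b * (1 + \<bar>c'\<bar>) = \<bar>s - c'\<bar>"
      using w by (simp add: b_def)
    finally show ?thesis by (simp add: add_divide_distrib)
  qed
  also have "\<bar>\<dots>\<bar> \<le> \<bar>c - c'\<bar> + (1 + \<bar>s\<bar>) * \<bar>c - c'\<bar>"
  proof (intro order_trans[OF abs_triangle_ineq] add_mono)
    have *: "\<bar>x / (1 + \<bar>c\<bar>)\<bar> \<le> \<bar>x\<bar>" for x
      by (simp add: divide_le_eq abs_div algebra_simps)
    show "\<bar>(\<bar>s - c\<bar> - \<bar>s - c'\<bar>) / (1 + \<bar>c\<bar>)\<bar> \<le> \<bar>c - c'\<bar>"
      by (rule order_trans[OF *]) auto
    have "\<bar>(\<bar>c'\<bar> - \<bar>c\<bar>) / (1 + \<bar>c\<bar>)\<bar> \<le> \<bar>c - c'\<bar>"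
      by (rule order_trans[OF *]) auto
    moreover have "\<bar>b\<bar> \<le> 1 + \<bar>s\<bar>" using bound[of c'] by (simp add: b_def)
    ultimately show "\<bar>b * ((\<bar>c'\<bar> - \<bar>c\<bar>) / (1 + \<bar>c\<bar>))\<bar> \<le> (1 + \<bar>s\<bar>) * \<bar>c - c'\<bar>"
      unfolding abs_mult by (intro mult_mono) auto
  qed
  \<comment> \<open>One copy of \<open>\<bar>c - c'\<bar>\<close> comes from the numerators, the
    other from the denominators; this is the factor 2 in the Lipschitz constant.\<close>
  also have "\<dots> \<le> (1 + \<bar>s\<bar>) * (2 * \<bar>c - c'\<bar>)"
    by (simp add: algebra_simps)
  finally have ab: "\<bar>a - b\<bar> \<le> (1 + \<bar>s\<bar>) * (2 * \<bar>c - c'\<bar>)" .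
  have "a powr p \<le> b powr p + p * (1 + \<bar>s\<bar>) powr (p - 1) * \<bar>a - b\<bar>"
    using assms bound[of c] by (intro powr_diff_le) (auto simp: a_def b_def)
  also have "\<dots> \<le> b powr p + p * (1 + \<bar>s\<bar>) powr (p - 1) * ((1 + \<bar>s\<bar>) * (2 * \<bar>c - c'\<bar>))"
    using ab assms by (intro add_left_mono mult_left_mono) auto
  also have "\<dots> = b powr p + 2 * p * \<bar>c - c'\<bar> * ((1 + \<bar>s\<bar>) powr (p - 1) * (1 + \<bar>s\<bar>) powr 1)"
    by simp
  also have "\<dots> = b powr p + 2 * p * \<bar>c - c'\<bar> * (1 + \<bar>s\<bar>) powr p"
    by (simp only: powr_add[symmetric]) simp
  finally show ?thesis by (simp add: a_def b_def powr_divide)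
qed

text \<open>McShane extension from the rationals to the reals.\<close>

definition lipschitz_ext :: "(rat \<Rightarrow> real) \<Rightarrow> real \<Rightarrow> real \<Rightarrow> real" where
  "lipschitz_ext t L c = (INF r. t r + L * \<bar>c - real_of_rat r\<bar>)"

context
  fixes t :: "rat \<Rightarrow> real" and L :: real
  assumes nonneg: "\<And>r. 0 \<le> t r" "0 \<le> L"
begin

lemma lipschitz_ext_bdd: "bdd_below (range (\<lambda>r. t r + L * \<bar>c - real_of_rat r\<bar>))"
  using nonneg by (intro bdd_belowI2[where m=0]) auto

lemma lipschitz_ext_le: "lipschitz_ext t L c \<le> t r + L * \<bar>c - real_of_rat r\<bar>"
  unfolding lipschitz_ext_def using lipschitz_ext_bdd by (intro cINF_lower) auto

lemma lipschitz_ext_ge: "(\<And>r. m \<le> t r + L * \<bar>c - real_of_rat r\<bar>) \<Longrightarrow> m \<le> lipschitz_ext t L c"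
  unfolding lipschitz_ext_def by (intro cINF_greatest) auto

lemma lipschitz_ext_lipschitz: "lipschitz_ext t L c \<le> lipschitz_ext t L c' + L * \<bar>c - c'\<bar>"
proof -
  have "lipschitz_ext t L c - L * \<bar>c - c'\<bar> \<le> lipschitz_ext t L c'"
  proof (rule lipschitz_ext_ge)
    fix r
    have "L * \<bar>c - real_of_rat r\<bar> \<le> L * (\<bar>c - c'\<bar> + \<bar>c' - real_of_rat r\<bar>)"
      using nonneg by (intro mult_left_mono) auto
    then show "lipschitz_ext t L c - L * \<bar>c - c'\<bar> \<le> t r + L * \<bar>c' - real_of_rat r\<bar>"
      using lipschitz_ext_le[of c r] by (simp add: distrib_left)
  qed
  then show ?thesis by simp
qed

lemma continuous_on_lipschitz_ext: "continuous_on A (lipschitz_ext t L)"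
proof (rule lipschitz_on_continuous_on[where L=L], rule lipschitz_onI)
  show "dist (lipschitz_ext t L x) (lipschitz_ext t L y) \<le> L * dist x y" for x y
    using lipschitz_ext_lipschitz[of x y] lipschitz_ext_lipschitz[of y x]
    by (simp add: dist_real_def abs_minus_commute abs_le_iff)
qed (use nonneg in auto)

text \<open>Only the single value \<open>v\<close> at \<open>c\<close> has to be compatible with all
  rational values. For fixed \<open>c\<close> these are countably many conditions, so they can hold
  simultaneously outside one null set.\<close>

lemma lipschitz_ext_eqI:
  assumes "\<And>r. v \<le> t r + L * \<bar>c - real_of_rat r\<bar>" "\<And>r. t r \<le> v + L * \<bar>c - real_of_rat r\<bar>"
  shows "lipschitz_ext t L c = v"
proof (rule antisym)
  show "lipschitz_ext t L c \<le> v"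
  proof (rule field_le_epsilon)
    fix e :: real assume "e > 0"
    \<comment> \<open>Passing to a rational within \<open>d\<close> and back costs
      \<open>2 * L * d\<close>; the summand 1 covers \<open>L = 0\<close>.\<close>
    define d where "d = e / (2 * L + 1)"
    have "d > 0" using \<open>e > 0\<close> nonneg by (simp add: d_def)
    then obtain r where r: "c < real_of_rat r" "real_of_rat r < c + d"
      using of_rat_dense[of c "c + d"] by auto
    have "lipschitz_ext t L c \<le> v + 2 * (L * \<bar>c - real_of_rat r\<bar>)"
      using lipschitz_ext_le[of c r] assms(2)[of r] by simp
    also have "L * \<bar>c - real_of_rat r\<bar> \<le> L * d"
      using r nonneg by (intro mult_left_mono) auto
    also have "v + 2 * (L * d) \<le> v + (2 * L + 1) * d"
      using \<open>d > 0\<close> by (simp add: algebra_simps)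
    also have "\<dots> = v + e" using nonneg by (simp add: d_def)
    finally show "lipschitz_ext t L c \<le> v + e" by simp
  qed
qed (rule lipschitz_ext_ge, rule assms)

end

lemma continuous_le_if_le_rat:
  fixes F G :: "real \<Rightarrow> 'b::linorder_topology"
  assumes "continuous_on UNIV F" "continuous_on UNIV G" "\<And>r. F (real_of_rat r) \<le> G (real_of_rat r)"
  shows "F c \<le> G c"
proof -
  have "closed {c. F c \<le> G c}" using assms by (intro closed_Collect_le) auto
  moreover have "\<rat> \<subseteq> {c. F c \<le> G c}" using assms(3) by (auto simp: Rats_def)
  ultimately have "closure \<rat> \<subseteq> {c. F c \<le> G c}" by (rule closure_minimal[rotated])
  then show ?thesis by (auto simp: Rats_closure_real)
qed

section \<open>Existence, mass and finiteness of extensions for functions in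
  \<open>L\<^sup>1 + L\<^sup>\<infinity>\<close>\<close>

context conservative_operator
begin

text \<open>Integrable test functions have finite mass, which is what cancellation in
  \<open>ennreal\<close> requires. A general \<open>v\<close> is the increasing limit of its
  restrictions to the sets where \<open>v \<ge> 1 / (n + 1)\<close>, and there
  \<open>v \<le> (n + 1) * v * v\<close> is integrable.\<close>

lemma positive_ext_if_integrable:
  assumes [measurable]: "h \<in> borel_measurable M" "g \<in> borel_measurable M"
    and eq: "\<And>u. u \<in> Lp M 2 \<Longrightarrow> integrable M u \<Longrightarrow> (\<And>x. 0 \<le> u x) \<Longrightarrow>
      (\<integral>\<^sup>+x. g x * ennreal (u x) \<partial>M) = (\<integral>\<^sup>+x. h x * ennreal (T u x) \<partial>M)"
  shows "positive_ext M T h g"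
  unfolding positive_ext_def
proof (intro conjI ballI impI)
  fix v assume v: "v \<in> Lp M 2" "AE x in M. 0 \<le> v x"
  define u where "u n x = (if 1 / real (Suc n) \<le> v x then v x else 0)" for n x
  have [measurable]: "v \<in> borel_measurable M" "T v \<in> borel_measurable M"
    using v measurable_T Lp_measurable by blast+
  have [measurable]: "u n \<in> borel_measurable M" for n unfolding u_def by measurable
  have u: "u n \<in> Lp M 2" for n by (rule L2_bound[OF v(1)]) (auto simp: u_def)
  then have [measurable]: "T (u n) \<in> borel_measurable M" for n using measurable_T by blast
  have u0: "0 \<le> u n x" for n x
  proof -
    have "0 < 1 / real (Suc n)" by simp
    then show ?thesis unfolding u_def by (smt (verit))
  qed
  have mono: "u n x \<le> u (Suc n) x" for n x
  proof -
    have "1 / real (Suc (Suc n)) \<le> 1 / real (Suc n)" by (intro divide_left_mono) auto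
    then show ?thesis using u0[of "Suc n" x] by (auto simp: u_def)
  qed
  have int: "integrable M (u n)" for n
  proof (rule Bochner_Integration.integrable_bound)
    show "integrable M (\<lambda>x. real (Suc n) * (v x * v x))"
      using v by (auto simp: Lp_2_iff)
    have "\<bar>u n x\<bar> \<le> real (Suc n) * (v x * v x)" for x
    proof (cases "1 / real (Suc n) \<le> v x")
      case True
      then have "1 \<le> real (Suc n) * v x" by (simp add: field_simps)
      moreover have "0 \<le> v x" using True by (smt (verit) zero_le_divide_1_iff of_nat_0_le_iff)
      ultimately have "1 * v x \<le> real (Suc n) * v x * v x" by (intro mult_right_mono)
      then show ?thesis using \<open>0 \<le> v x\<close> by (simp add: u_def mult.assoc)
    qed (simp add: u_def)
    then show "AE x in M. norm (u n x) \<le> norm (real (Suc n) * (v x * v x))"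
      by (intro AE_I2) (metis abs_ge_self order_trans real_norm_def)
  qed simp
  have SUP: "(SUP n. ennreal (u n x)) = ennreal (v x)" for x
  proof (cases "v x > 0")
    case True
    then obtain n where "1 / real (Suc n) < v x" using nat_approx_posE by blast
    then have "ennreal (v x) = ennreal (u n x)" by (simp add: u_def)
    also have "\<dots> \<le> (SUP n. ennreal (u n x))" by (rule SUP_upper) simp
    finally show ?thesis
      by (intro antisym SUP_least ennreal_leI) (use True in \<open>auto simp: u_def\<close>)
  next
    case False
    have "0 < 1 / real (Suc n)" for n by simp
    then have "u n x = 0" for n using False unfolding u_def by (smt (verit))
    then show ?thesis using False by (simp add: ennreal_neg)
  qed
  have "positive_ext M T (\<lambda>x. ennreal (v x)) (\<lambda>x. SUP n. ennreal (T (u n) x))"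
    using positive_ext_SUP[of u, OF u u0 mono] by (simp add: SUP)
  from positive_ext_unique[OF this positive_ext_L2[OF v]]
  have TSUP: "AE x in M. (SUP n. ennreal (T (u n) x)) = ennreal (T v x)" .
  have "(\<integral>\<^sup>+x. g x * ennreal (v x) \<partial>M) = (\<integral>\<^sup>+x. (SUP n. g x * ennreal (u n x)) \<partial>M)"
    by (simp add: SUP[symmetric] SUP_mult_left_ennreal)
  also have "\<dots> = (SUP n. \<integral>\<^sup>+x. g x * ennreal (u n x) \<partial>M)"
    using mono by (intro nn_integral_monotone_convergence_SUP)
      (auto simp: incseq_Suc_iff le_fun_def intro!: mult_left_mono ennreal_leI)
  also have "\<dots> = (SUP n. \<integral>\<^sup>+x. h x * ennreal (T (u n) x) \<partial>M)"
    by (simp add: eq[OF u int u0])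
  also have "\<dots> = (\<integral>\<^sup>+x. (SUP n. h x * ennreal (T (u n) x)) \<partial>M)"
  proof (rule nn_integral_monotone_convergence_SUP_AE[symmetric])
    fix n
    show "AE x in M. h x * ennreal (T (u n) x) \<le> h x * ennreal (T (u (Suc n)) x)"
      using T_incseq[of u, OF u mono] by (auto elim!: eventually_mono intro: mult_left_mono)
  qed measurable
  also have "\<dots> = (\<integral>\<^sup>+x. h x * (SUP n. ennreal (T (u n) x)) \<partial>M)"
    by (simp add: SUP_mult_left_ennreal)
  also have "\<dots> = (\<integral>\<^sup>+x. h x * ennreal (T v x) \<partial>M)"
    using TSUP by (intro nn_integral_cong_AE) (auto elim: eventually_mono)
  finally show "(\<integral>\<^sup>+x. g x * ennreal (v x) \<partial>M) = (\<integral>\<^sup>+x. h x * ennreal (T v x) \<partial>M)" .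
qed (use assms in auto)

text \<open>For an integrable test function, \<open>u\<close> and \<open>T u\<close> have the same
  finite mass. Splitting this mass along \<open>g\<close> and along \<open>h\<close> and cancelling
  the equal parts leaves the complements.\<close>

lemma positive_ext_complement:
  assumes ext: "positive_ext M T h g" and le: "\<And>x. h x \<le> 1"
  shows "positive_ext M T (\<lambda>x. 1 - h x) (\<lambda>x. 1 - g x)"
proof (rule positive_ext_if_integrable)
  have [measurable]: "h \<in> borel_measurable M" "g \<in> borel_measurable M"
    using ext by (auto simp: positive_ext_def)
  have g1: "AE x in M. g x \<le> 1"
    using positive_ext_mono[OF ext conservative] le by simp
  show "(\<lambda>x. 1 - h x) \<in> borel_measurable M" "(\<lambda>x. 1 - g x) \<in> borel_measurable M"
    by measurable
  fix u assume u: "u \<in> Lp M 2" "integrable M u" "\<And>x. 0 \<le> u x"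
  have [measurable]: "u \<in> borel_measurable M" "T u \<in> borel_measurable M"
    using u measurable_T Lp_measurable by blast+
  have split: "(\<integral>\<^sup>+x. (1 - k x) * ennreal (v x) \<partial>M) + (\<integral>\<^sup>+x. k x * ennreal (v x) \<partial>M) =
      (\<integral>\<^sup>+x. ennreal (v x) \<partial>M)"
    if [measurable]: "k \<in> borel_measurable M" "v \<in> borel_measurable M" and k: "AE x in M. k x \<le> 1" for k v
  proof -
    have "(\<integral>\<^sup>+x. (1 - k x) * ennreal (v x) \<partial>M) + (\<integral>\<^sup>+x. k x * ennreal (v x) \<partial>M) =
        (\<integral>\<^sup>+x. (1 - k x) * ennreal (v x) + k x * ennreal (v x) \<partial>M)"
      by (rule nn_integral_add[symmetric]) measurable
    also have "\<dots> = (\<integral>\<^sup>+x. ennreal (v x) \<partial>M)"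
      using k
    proof (intro nn_integral_cong_AE, eventually_elim)
      case (elim x)
      show ?case
        by (subst distrib_right[symmetric]) (simp add: diff_add_cancel_ennreal[OF elim(2)])
    qed
    finally show ?thesis .
  qed
  have eq: "(\<integral>\<^sup>+x. g x * ennreal (u x) \<partial>M) = (\<integral>\<^sup>+x. h x * ennreal (T u x) \<partial>M)"
    "(\<integral>\<^sup>+x. ennreal (T u x) \<partial>M) = (\<integral>\<^sup>+x. ennreal (u x) \<partial>M)"
    using ext nn_integral_T u by (auto simp: positive_ext_def)
  have "(\<integral>\<^sup>+x. g x * ennreal (u x) \<partial>M) \<le>
      (\<integral>\<^sup>+x. (1 - g x) * ennreal (u x) \<partial>M) + (\<integral>\<^sup>+x. g x * ennreal (u x) \<partial>M)"
    by simp
  also have "\<dots> = (\<integral>\<^sup>+x. ennreal (u x) \<partial>M)" by (rule split) (use g1 in measurable)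
  also have "\<dots> < \<infinity>" using u(2) by (simp add: integrable_iff_bounded u(3))
  finally have fin: "(\<integral>\<^sup>+x. g x * ennreal (u x) \<partial>M) \<noteq> \<infinity>" by simp
  have "(\<integral>\<^sup>+x. g x * ennreal (u x) \<partial>M) + (\<integral>\<^sup>+x. (1 - g x) * ennreal (u x) \<partial>M) =
      (\<integral>\<^sup>+x. g x * ennreal (u x) \<partial>M) + (\<integral>\<^sup>+x. (1 - h x) * ennreal (T u x) \<partial>M)"
  proof -
    have "(\<integral>\<^sup>+x. (1 - g x) * ennreal (u x) \<partial>M) + (\<integral>\<^sup>+x. g x * ennreal (u x) \<partial>M) =
        (\<integral>\<^sup>+x. ennreal (u x) \<partial>M)"
      by (rule split) (use g1 in measurable)
    also have "\<dots> = (\<integral>\<^sup>+x. ennreal (T u x) \<partial>M)" by (rule eq(2)[symmetric])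
    also have "\<dots> = (\<integral>\<^sup>+x. (1 - h x) * ennreal (T u x) \<partial>M) + (\<integral>\<^sup>+x. h x * ennreal (T u x) \<partial>M)"
    proof (rule split[symmetric])
      show "AE x in M. h x \<le> 1" using le by simp
    qed measurable
    finally show ?thesis unfolding eq(1) by (metis add.commute)
  qed
  then show "(\<integral>\<^sup>+x. (1 - g x) * ennreal (u x) \<partial>M) = (\<integral>\<^sup>+x. (1 - h x) * ennreal (T u x) \<partial>M)"
    using fin unfolding ennreal_add_left_cancel by blast
qed

lemma Lp_truncation:
  assumes f: "f \<in> Lp M p" "0 \<le> p" and k: "k \<in> borel_measurable borel" "\<And>s. 0 \<le> k s"
  defines "u \<equiv> \<lambda>n::nat. \<lambda>x. if 1 / real (Suc n) \<le> \<bar>f x\<bar> then min (k (f x)) (real n) else 0"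
  shows "u n \<in> Lp M 2" "0 \<le> u n x" "u n x \<le> u (Suc n) x"
proof -
  have [measurable]: "f \<in> borel_measurable M" "k \<in> borel_measurable borel"
    using f Lp_measurable k by blast+
  show "u n \<in> Lp M 2"
  proof (rule L2_bounded_on_finite)
    show "emeasure M {x\<in>space M. \<bar>f x\<bar> \<ge> 1 / real (Suc n)} < \<infinity>"
      by (rule Lp_superlevel_finite[OF f(1)]) (use f in auto)
    show "\<bar>u n x\<bar> \<le> real n * indicator {x\<in>space M. \<bar>f x\<bar> \<ge> 1 / real (Suc n)} x" if "x \<in> space M" for x
      using k(2)[of "f x"] that by (auto simp: u_def)
  qed (unfold u_def, measurable)
  show "0 \<le> u n x" using k(2) by (simp add: u_def)
  have "1 / real (Suc (Suc n)) \<le> 1 / real (Suc n)" by (intro divide_left_mono) auto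
  then show "u n x \<le> u (Suc n) x" using k(2)[of "f x"] unfolding u_def by (auto simp: min_def)
qed

lemma positive_ext_away_from_zero:
  assumes f: "f \<in> Lp M p" "0 \<le> p" and k: "k \<in> borel_measurable borel" "\<And>s. 0 \<le> k s"
  shows "\<exists>g. positive_ext M T (\<lambda>x. if f x \<noteq> 0 then ennreal (k (f x)) else 0) g \<and>
    (\<integral>\<^sup>+x. g x \<partial>M) = (\<integral>\<^sup>+x. (if f x \<noteq> 0 then ennreal (k (f x)) else 0) \<partial>M)"
proof -
  define u where "u n x = (if 1 / real (Suc n) \<le> \<bar>f x\<bar> then min (k (f x)) (real n) else 0)" for n x
  have u: "u n \<in> Lp M 2" "0 \<le> u n x" "u n x \<le> u (Suc n) x" for n x
    unfolding u_def using Lp_truncation[OF f k] by blast+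
  have "(SUP n. ennreal (u n x)) = (if f x \<noteq> 0 then ennreal (k (f x)) else 0)" for x
    unfolding u_def by (rule SUP_truncation[OF k(2)])
  then show ?thesis
    using positive_ext_SUP[of u, OF u] nn_integral_T_SUP[of u, OF u] by auto
qed

text \<open>The monotone limit construction preserves mass, and uniqueness transfers this to any
  other version. Because \<open>k 0 = 0\<close>, nothing is lost on the zero set of
  \<open>f\<close>.\<close>

lemma nn_integral_positive_ext:
  assumes f: "f \<in> Lp M p" "0 \<le> p" and k: "k \<in> borel_measurable borel" "\<And>s. 0 \<le> k s" "k 0 = 0"
    and g: "positive_ext M T (\<lambda>x. ennreal (k (f x))) g"
  shows "(\<integral>\<^sup>+x. g x \<partial>M) = (\<integral>\<^sup>+x. ennreal (k (f x)) \<partial>M)"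
proof -
  have eq: "(if f x \<noteq> 0 then ennreal (k (f x)) else 0) = ennreal (k (f x))" for x using k(3) by simp
  obtain g' where g': "positive_ext M T (\<lambda>x. ennreal (k (f x))) g'"
    "(\<integral>\<^sup>+x. g' x \<partial>M) = (\<integral>\<^sup>+x. ennreal (k (f x)) \<partial>M)"
    using positive_ext_away_from_zero[OF f k(1,2)] unfolding eq by blast
  have "(\<integral>\<^sup>+x. g x \<partial>M) = (\<integral>\<^sup>+x. g' x \<partial>M)"
    using positive_ext_unique[OF g g'(1)] by (intro nn_integral_cong_AE)
  then show ?thesis using g'(2) by simp
qed

text \<open>On the zero set of \<open>f\<close> the function is the constant \<open>k 0\<close>.
  That set may have infinite measure, so its indicator is extended as the complement of the
  indicator of \<open>f x \<noteq> 0\<close>, which is approximable in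
  \<open>L\<^sup>2\<close>.\<close>

lemma positive_ext_exists:
  assumes f: "f \<in> Lp M p" "0 \<le> p" and k: "k \<in> borel_measurable borel" "\<And>s. 0 \<le> k s"
  shows "\<exists>g. positive_ext M T (\<lambda>x. ennreal (k (f x))) g"
proof -
  obtain g1 where g1: "positive_ext M T (\<lambda>x. if f x \<noteq> 0 then ennreal (k (f x)) else 0) g1"
    using positive_ext_away_from_zero[OF f k] by blast
  obtain g2 where g2: "positive_ext M T (\<lambda>x. if f x \<noteq> 0 then 1 else 0) g2"
    using positive_ext_away_from_zero[OF f, of "\<lambda>_. 1"] unfolding ennreal_1 by fastforce
  have "positive_ext M T (\<lambda>x. (if f x \<noteq> 0 then ennreal (k (f x)) else 0) +
      ennreal (k 0) * (1 - (if f x \<noteq> 0 then 1 else 0))) (\<lambda>x. g1 x + ennreal (k 0) * (1 - g2 x))"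
    by (intro positive_ext_add g1 positive_ext_cmult positive_ext_complement g2) auto
  moreover have "(\<lambda>x. (if f x \<noteq> 0 then ennreal (k (f x)) else 0) +
      ennreal (k 0) * (1 - (if f x \<noteq> 0 then 1 else 0))) = (\<lambda>x. ennreal (k (f x)))"
    by auto
  ultimately show ?thesis by metis
qed

text \<open>Let \<open>B\<close> have finite measure with \<open>g = \<infinity>\<close> on it.
  Since \<open>T (indicator B)\<close> is at most 1 and has mass \<open>emeasure M B\<close>, the
  integral of \<open>g\<close> over \<open>B\<close> is at most \<open>K * emeasure M B\<close> plus
  the integral of \<open>h'\<close>. This is finite, so \<open>B\<close> is null.\<close>

lemma positive_ext_finite:
  assumes ext: "positive_ext M T h g" and [measurable]: "h' \<in> borel_measurable M"
    and le: "\<And>x. h x \<le> ennreal K + h' x" and fin: "(\<integral>\<^sup>+x. h' x \<partial>M) < \<infinity>"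
  shows "AE x in M. g x < \<infinity>"
proof -
  have [measurable]: "g \<in> borel_measurable M" using ext by (simp add: positive_ext_def)
  have "AE x in M. \<not> (g x = \<infinity>)"
  proof (rule AE_not_if_no_finite_subset)
    fix B assume B[measurable]: "B \<in> sets M" and inf: "\<And>x. x \<in> B \<Longrightarrow> g x = \<infinity>" and "emeasure M B < \<infinity>"
    have iB: "indicator B \<in> Lp M 2" "AE x in M. 0 \<le> (indicator B x :: real)"
      using L2_indicator[OF B \<open>emeasure M B < \<infinity>\<close>] by auto
    have [measurable]: "T (indicator B) \<in> borel_measurable M" using iB measurable_T by blast
    have TB: "AE x in M. 0 \<le> T (indicator B) x \<and> T (indicator B) x \<le> 1"
      by (rule markovian[OF iB(1)]) (simp add: indicator_def)
    have "\<infinity> * emeasure M B = (\<integral>\<^sup>+x. \<infinity> * indicator B x \<partial>M)"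
      by (simp add: nn_integral_cmult_indicator)
    also have "\<dots> = (\<integral>\<^sup>+x. g x * ennreal (indicator B x) \<partial>M)"
      using inf by (intro nn_integral_cong) (auto simp: indicator_def)
    also have "\<dots> = (\<integral>\<^sup>+x. h x * ennreal (T (indicator B) x) \<partial>M)"
      using ext iB by (auto simp: positive_ext_def)
    also have "\<dots> \<le> (\<integral>\<^sup>+x. ennreal K * ennreal (T (indicator B) x) + h' x \<partial>M)"
      using TB
    proof (intro nn_integral_mono_AE, eventually_elim)
      case (elim x)
      have "h x * ennreal (T (indicator B) x) \<le> (ennreal K + h' x) * ennreal (T (indicator B) x)"
        by (intro mult_right_mono le) auto
      also have "\<dots> = ennreal K * ennreal (T (indicator B) x) + h' x * ennreal (T (indicator B) x)"
        by (rule distrib_right)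
      also have "h' x * ennreal (T (indicator B) x) \<le> h' x * 1"
        using elim by (intro mult_left_mono) (auto simp: ennreal_le_1)
      finally show ?case by (simp add: add_left_mono)
    qed
    also have "\<dots> = ennreal K * (\<integral>\<^sup>+x. ennreal (T (indicator B) x) \<partial>M) + (\<integral>\<^sup>+x. h' x \<partial>M)"
      by (simp add: nn_integral_add nn_integral_cmult)
    also have "\<dots> = ennreal K * emeasure M B + (\<integral>\<^sup>+x. h' x \<partial>M)"
      using nn_integral_T[OF iB] by (simp add: ennreal_indicator)
    also have "\<dots> < \<infinity>" using fin \<open>emeasure M B < \<infinity>\<close> by (simp add: ennreal_mult_less_top)
    finally show "emeasure M B = 0" by (metis ennreal_top_mult infinity_ennreal_def less_irrefl)
  qed measurable
  then show ?thesis by (auto elim: eventually_mono simp: top.not_eq_extremum)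
qed

end

section \<open>Increment integrals\<close>

text \<open>Rounding \<open>f\<close> down to the grid of mesh \<open>1 / (n + 1)\<close> leaves
  countably many values of the second argument, where measurability is given; continuity in that
  argument yields the limit.\<close>

lemma borel_measurable_caratheodory:
  fixes G :: "'a \<Rightarrow> real \<Rightarrow> ennreal"
  assumes [measurable]: "\<And>c. (\<lambda>y. G y c) \<in> borel_measurable M" "f \<in> borel_measurable M"
    and cont: "\<And>y. continuous_on UNIV (G y)"
  shows "(\<lambda>y. G y (f y)) \<in> borel_measurable M"
proof (rule borel_measurable_LIMSEQ_order)
  let ?r = "\<lambda>n x. real_of_int \<lfloor>real (Suc n) * x\<rfloor> / real (Suc n)"
  show "(\<lambda>y. G y (?r n (f y))) \<in> borel_measurable M" for n
  proof (rule measurable_compose_countable[where f="\<lambda>i y. G y (real_of_int i / real (Suc n))"])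
    show "(\<lambda>y. \<lfloor>real (Suc n) * f y\<rfloor>) \<in> measurable M (count_space UNIV)" by measurable
  qed (rule assms)
  fix y
  have "(\<lambda>n. ?r n (f y)) \<longlonglongrightarrow> f y"
  proof (rule LIMSEQ_I)
    fix e :: real assume "0 < e"
    then obtain N where N: "1 / real (Suc N) < e" by (rule nat_approx_posE)
    have "norm (?r n (f y) - f y) < e" if "n \<ge> N" for n
    proof -
      have "?r n (f y) - f y = (real_of_int \<lfloor>real (Suc n) * f y\<rfloor> - real (Suc n) * f y) / real (Suc n)"
        by (simp add: diff_divide_distrib)
      also have "\<bar>\<dots>\<bar> \<le> 1 / real (Suc n)"
      proof -
        have "\<bar>real_of_int \<lfloor>real (Suc n) * f y\<rfloor> - real (Suc n) * f y\<bar> \<le> 1" by linarith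
        then show ?thesis
          unfolding abs_divide abs_of_nat by (rule divide_right_mono) simp
      qed
      also have "\<dots> \<le> 1 / real (Suc N)" using that by (intro divide_left_mono) auto
      finally show ?thesis using N unfolding real_norm_def by linarith
    qed
    then show "\<exists>N. \<forall>n\<ge>N. norm (?r n (f y) - f y) < e" by blast
  qed
  then show "(\<lambda>n. G y (?r n (f y))) \<longlonglongrightarrow> G y (f y)"
    by (rule continuous_on_tendsto_compose[OF cont[of y], where g="\<lambda>n. ?r n (f y)"]) auto
qed

context conservative_operator
begin

text \<open>Versions \<open>\<tau> c\<close> chosen separately for each \<open>c\<close> come with
  null sets depending on \<open>c\<close>. After normalization by \<open>w\<close> they satisfy a
  Lipschitz bound whose constant \<open>L y\<close> arises by applying the operator to the constant
  of \<open>normalized_powr_lipschitz\<close>. It is finite almost everywhere, so the rational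
  values determine a continuous function of \<open>c\<close>.\<close>

lemma continuous_version_exists:
  assumes f: "f \<in> Lp M p" and p: "1 \<le> p"
  shows "\<exists>G. continuous_version M T p f G"
proof -
  have p0: "0 \<le> p" using p by simp
  have [measurable]: "f \<in> borel_measurable M" using f Lp_measurable by blast
  have "\<exists>g. positive_ext M T (\<lambda>x. ennreal (\<bar>f x - c\<bar> powr p)) g" for c
    by (rule positive_ext_exists[OF f p0, of "\<lambda>s. \<bar>s - c\<bar> powr p"]) auto
  then obtain \<tau> where \<tau>: "\<And>c. positive_ext M T (\<lambda>x. ennreal (\<bar>f x - c\<bar> powr p)) (\<tau> c)"
    by metis
  obtain H where H: "positive_ext M T (\<lambda>x. ennreal ((1 + \<bar>f x\<bar>) powr p)) H"
    using positive_ext_exists[OF f p0, of "\<lambda>s. (1 + \<bar>s\<bar>) powr p"] by auto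
  have [measurable]: "\<And>c. \<tau> c \<in> borel_measurable M" "H \<in> borel_measurable M"
    using \<tau> H by (auto simp: positive_ext_def)
  define w where "w c = (1 + \<bar>c\<bar>) powr p" for c :: real
  have w: "0 < w c" for c by (simp add: w_def)
  have fin_f: "(\<integral>\<^sup>+x. ennreal (\<bar>f x\<bar> powr p) \<partial>M) < \<infinity>"
    using f by (simp add: Lp_def integrable_iff_bounded)
  have bound: "(1 + \<bar>s\<bar>) powr p \<le> 2 powr p + 2 powr p * \<bar>s\<bar> powr p" for s :: real
  proof -
    have "(1 + \<bar>s\<bar>) powr p \<le> (2 * max 1 \<bar>s\<bar>) powr p" using p by (intro powr_mono2) auto
    also have "\<dots> = 2 powr p * max 1 \<bar>s\<bar> powr p" by (simp add: powr_mult)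
    also have "max 1 \<bar>s\<bar> powr p \<le> 1 + \<bar>s\<bar> powr p" by (auto simp: max_def)
    finally show ?thesis by (simp add: distrib_left)
  qed
  have Hfin: "AE y in M. H y < \<infinity>"
  proof (rule positive_ext_finite[OF H, where K="2 powr p" and h'="\<lambda>x. ennreal (2 powr p) * ennreal (\<bar>f x\<bar> powr p)"])
    show "ennreal ((1 + \<bar>f x\<bar>) powr p) \<le> ennreal (2 powr p) + ennreal (2 powr p) * ennreal (\<bar>f x\<bar> powr p)" for x
      using bound[of "f x"] by (simp add: ennreal_mult[symmetric] ennreal_plus[symmetric] del: ennreal_plus)
    show "(\<integral>\<^sup>+x. ennreal (2 powr p) * ennreal (\<bar>f x\<bar> powr p) \<partial>M) < \<infinity>"
      using fin_f by (simp add: nn_integral_cmult ennreal_mult_less_top)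
  qed measurable
  have \<tau>_H: "AE y in M. \<tau> c y \<le> ennreal (w c) * H y" for c
  proof (rule positive_ext_mono[OF \<tau> positive_ext_cmult[OF H]], rule AE_I2)
    fix x
    have "\<bar>f x - c\<bar> \<le> \<bar>f x\<bar> + \<bar>c\<bar>" "0 \<le> \<bar>c\<bar> * \<bar>f x\<bar>" by simp_all
    moreover have "(1 + \<bar>c\<bar>) * (1 + \<bar>f x\<bar>) = 1 + \<bar>f x\<bar> + \<bar>c\<bar> + \<bar>c\<bar> * \<bar>f x\<bar>"
      by (simp add: algebra_simps)
    ultimately have "\<bar>f x - c\<bar> \<le> (1 + \<bar>c\<bar>) * (1 + \<bar>f x\<bar>)" by linarith
    then have "\<bar>f x - c\<bar> powr p \<le> ((1 + \<bar>c\<bar>) * (1 + \<bar>f x\<bar>)) powr p"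
      using p by (intro powr_mono2) auto
    then show "ennreal (\<bar>f x - c\<bar> powr p) \<le> ennreal (w c) * ennreal ((1 + \<bar>f x\<bar>) powr p)"
      using w[of c] by (simp add: w_def powr_mult ennreal_mult[symmetric] ennreal_leI)
  qed
  define t where "t y c = enn2real (\<tau> c y) / w c" for y c
  define L where "L y = 2 * p * enn2real (H y)" for y
  have L0: "0 \<le> L y" and t0: "0 \<le> t y c" for y c using p w[of c] by (auto simp: L_def t_def)
  have lip: "AE y in M. t y c \<le> t y c' + L y * \<bar>c - c'\<bar>" for c c'
  proof -
    have "AE y in M. ennreal (1 / w c) * \<tau> c y \<le> ennreal (1 / w c') * \<tau> c' y + ennreal (2 * p * \<bar>c - c'\<bar>) * H y"
    proof (rule positive_ext_mono[OF positive_ext_cmult[OF \<tau>] positive_ext_add[OF positive_ext_cmult[OF \<tau>] positive_ext_cmult[OF H]]],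
        rule AE_I2)
      fix x
      show "ennreal (1 / w c) * ennreal (\<bar>f x - c\<bar> powr p) \<le> ennreal (1 / w c') * ennreal (\<bar>f x - c'\<bar> powr p) +
          ennreal (2 * p * \<bar>c - c'\<bar>) * ennreal ((1 + \<bar>f x\<bar>) powr p)"
        using normalized_powr_lipschitz[OF p, of "f x" c c'] w[of c] w[of c'] p
        by (simp add: w_def ennreal_mult[symmetric] ennreal_plus[symmetric] ennreal_leI del: ennreal_plus)
    qed
    then show ?thesis
      using \<tau>_H[of c] \<tau>_H[of c'] Hfin
    proof eventually_elim
      case (elim y)
      have "ennreal (w d) * H y < \<infinity>" for d
        using elim(4) by (simp add: ennreal_mult_less_top)
      then have fin: "\<tau> c y < \<infinity>" "\<tau> c' y < \<infinity>"
        using elim(2,3) le_less_trans by blast+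
      obtain a where a: "\<tau> c y = ennreal a" "0 \<le> a" using fin(1) by (cases "\<tau> c y") auto
      obtain b where b: "\<tau> c' y = ennreal b" "0 \<le> b" using fin(2) by (cases "\<tau> c' y") auto
      obtain h where h: "H y = ennreal h" "0 \<le> h" using elim(4) by (cases "H y") auto
      note abh = a b h
      have "ennreal (1 / w c * a) \<le> ennreal (1 / w c' * b + 2 * p * \<bar>c - c'\<bar> * h)"
        using elim(1) w[of c] w[of c'] p abh(2,4,6) unfolding abh
        by (simp add: ennreal_mult[symmetric] ennreal_plus[symmetric] del: ennreal_plus)
      then have "1 / w c * a \<le> 1 / w c' * b + 2 * p * \<bar>c - c'\<bar> * h"
        using w[of c'] p abh(2,4,6) by (subst (asm) ennreal_le_iff) auto
      then show ?case using abh by (simp add: t_def L_def mult.commute mult.left_commute)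
    qed
  qed
  \<comment> \<open>Where \<open>\<tau>\<close> or \<open>H\<close> is infinite,
    \<open>enn2real\<close> gives 0. The data stay nonnegative for every \<open>y\<close>, so
    \<open>G y\<close> is continuous for every \<open>y\<close> and not just almost every
    one.\<close>
  define G where "G y c = ennreal (w c * lipschitz_ext (\<lambda>r. t y (real_of_rat r)) (L y) c)" for y c
  have "continuous_version M T p f G"
    unfolding continuous_version_def
  proof (intro conjI allI)
    fix y show "continuous_on UNIV (G y)"
      unfolding G_def w_def
      by (intro continuous_on_ennreal continuous_intros continuous_on_lipschitz_ext L0 t0) auto
  next
    fix c
    \<comment> \<open>With the real number \<open>c\<close> fixed, only the pairs of
      \<open>c\<close> with a rational occur. The null set may depend on \<open>c\<close>, which is
      harmless because \<open>positive_ext\<close> is required for each \<open>c\<close>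
      separately.\<close>
    have "AE y in M. \<forall>r. t y c \<le> t y (real_of_rat r) + L y * \<bar>c - real_of_rat r\<bar> \<and>
        t y (real_of_rat r) \<le> t y c + L y * \<bar>real_of_rat r - c\<bar>"
      unfolding AE_all_countable using lip by (auto simp: AE_conj_iff)
    then have "AE y in M. \<tau> c y = G y c"
      using \<tau>_H[of c] Hfin
    proof eventually_elim
      case (elim y)
      have "lipschitz_ext (\<lambda>r. t y (real_of_rat r)) (L y) c = t y c"
        using elim(1) by (intro lipschitz_ext_eqI L0 t0) (auto simp: abs_minus_commute)
      moreover have "ennreal (w c) * H y < \<infinity>"
        using elim(3) by (simp add: ennreal_mult_less_top)
      then have "\<tau> c y < \<infinity>"
        using elim(2) le_less_trans by blast
      ultimately show ?case using w[of c] by (simp add: G_def t_def)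
    qed
    moreover have "(\<lambda>y. G y c) \<in> borel_measurable M"
      unfolding G_def lipschitz_ext_def t_def L_def by measurable
    ultimately show "positive_ext M T (\<lambda>x. ennreal (\<bar>f x - c\<bar> powr p)) (\<lambda>y. G y c)"
      by (rule positive_ext_cong_AE[OF \<tau>])
  qed
  then show ?thesis by blast
qed

text \<open>The choice made by \<open>SOME\<close> is immaterial: two versions agree at all rational
  \<open>c\<close> outside one null set, hence by continuity also at \<open>c = f y\<close>.\<close>

lemma increment_integral_eq:
  assumes G: "continuous_version M T p f G"
  shows "increment_integral M T p f = (\<integral>\<^sup>+y. G y (f y) \<partial>M)"
proof -
  define G' where "G' = (SOME G. continuous_version M T p f G)"
  have G': "continuous_version M T p f G'" using someI[of "continuous_version M T p f", OF G] by (simp add: G'_def)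
  have "AE y in M. \<forall>r. G' y (real_of_rat r) = G y (real_of_rat r)"
    unfolding AE_all_countable
  proof
    fix r
    have "positive_ext M T (\<lambda>x. ennreal (\<bar>f x - real_of_rat r\<bar> powr p)) (\<lambda>y. G' y (real_of_rat r))"
      "positive_ext M T (\<lambda>x. ennreal (\<bar>f x - real_of_rat r\<bar> powr p)) (\<lambda>y. G y (real_of_rat r))"
      using G G' by (simp_all add: continuous_version_def)
    then show "AE y in M. G' y (real_of_rat r) = G y (real_of_rat r)" by (rule positive_ext_unique)
  qed
  then have "AE y in M. G' y (f y) = G y (f y)"
  proof eventually_elim
    case (elim y)
    have cont: "continuous_on UNIV (G y)" "continuous_on UNIV (G' y)"
      using G G' by (simp_all add: continuous_version_def)
    show ?case
      using continuous_le_if_le_rat[OF cont, of "f y"] continuous_le_if_le_rat[OF cont(2,1), of "f y"] elim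
      by simp
  qed
  then show ?thesis
    unfolding increment_integral_def Let_def G'_def[symmetric] by (rule nn_integral_cong_AE)
qed

lemma continuous_version_measurable:
  assumes "continuous_version M T p f G" "f \<in> borel_measurable M"
  shows "(\<lambda>y. G y (f y)) \<in> borel_measurable M"
  by (rule borel_measurable_caratheodory[of G M f])
    (use assms in \<open>auto simp: continuous_version_def positive_ext_def\<close>)

text \<open>The only route by which pointwise inequalities reach increment integrals. The term with
  \<open>\<theta>\<close> is an error confined to a region of finite measure;
  \<open>\<theta> s\<close> and \<open>\<theta> c\<close> contribute equally, the former by
  preservation of mass, whence \<open>2 * b\<close>.\<close>

lemma increment_integral_compare:
  assumes f: "f \<in> Lp M q" "1 \<le> q" and g: "(\<lambda>x. \<phi> (f x)) \<in> Lp M p" "1 \<le> p"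
    and cont: "continuous_on UNIV \<phi>" "continuous_on UNIV \<theta>"
    and \<theta>: "(\<lambda>x. \<theta> (f x)) \<in> Lp M 2" "\<And>s. 0 \<le> \<theta> s"
    and ab: "0 \<le> a" "0 \<le> b"
    and le: "\<And>s c. \<bar>\<phi> s - \<phi> c\<bar> powr p \<le> a * \<bar>s - c\<bar> powr q + b * (\<theta> s + \<theta> c)"
  shows "increment_integral M T p (\<lambda>x. \<phi> (f x)) \<le>
    ennreal a * increment_integral M T q f + ennreal (2 * b) * (\<integral>\<^sup>+x. ennreal (\<theta> (f x)) \<partial>M)"
proof -
  obtain G where G: "continuous_version M T p (\<lambda>x. \<phi> (f x)) G"
    using continuous_version_exists[OF g] by blast
  obtain K where K: "continuous_version M T q f K"
    using continuous_version_exists[OF f] by blast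
  have [measurable]: "f \<in> borel_measurable M" using f Lp_measurable by blast
  have [measurable]: "(\<lambda>x. \<theta> (f x)) \<in> borel_measurable M" using \<theta>(1) Lp_measurable by blast
  have [measurable]: "T (\<lambda>x. \<theta> (f x)) \<in> borel_measurable M" using measurable_T[OF \<theta>(1)] .
  have [measurable]: "(\<lambda>y. K y (f y)) \<in> borel_measurable M"
    using continuous_version_measurable[OF K] by simp
  have contGK: "continuous_on UNIV (G y)" "continuous_on UNIV (K y)" for y
    using G K by (auto simp: continuous_version_def)
  have T\<theta>: "positive_ext M T (\<lambda>x. ennreal (\<theta> (f x))) (\<lambda>x. ennreal (T (\<lambda>x. \<theta> (f x)) x))"
    using positive_ext_L2[OF \<theta>(1)] \<theta>(2) by simp
  let ?R = "\<lambda>c y. ennreal a * K y c + ennreal b * (ennreal (T (\<lambda>x. \<theta> (f x)) y) + ennreal (\<theta> c))"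
  \<comment> \<open>The rational parameter is a value of \<open>f\<close>; the corresponding
    argument \<open>\<phi> (real_of_rat r)\<close> of \<open>G y\<close> may be irrational, but
    \<open>G\<close> is a version at every real argument.\<close>
  have "AE y in M. \<forall>r. G y (\<phi> (real_of_rat r)) \<le> ?R (real_of_rat r) y"
    unfolding AE_all_countable
  proof
    fix r
    let ?c = "real_of_rat r"
    have KE: "positive_ext M T (\<lambda>x. ennreal (\<bar>f x - ?c\<bar> powr q)) (\<lambda>y. K y ?c)"
      using K by (simp add: continuous_version_def)
    have GE: "positive_ext M T (\<lambda>x. ennreal (\<bar>\<phi> (f x) - \<phi> ?c\<bar> powr p)) (\<lambda>y. G y (\<phi> ?c))"
      using G by (simp add: continuous_version_def)
    show "AE y in M. G y (\<phi> ?c) \<le> ?R ?c y"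
    proof (rule positive_ext_mono[OF GE positive_ext_add[OF positive_ext_cmult[OF KE]
            positive_ext_cmult[OF positive_ext_add[OF T\<theta> positive_ext_const]]]], rule AE_I2)
      fix x
      show "ennreal (\<bar>\<phi> (f x) - \<phi> ?c\<bar> powr p) \<le> ennreal a * ennreal (\<bar>f x - ?c\<bar> powr q) +
          ennreal b * (ennreal (\<theta> (f x)) + ennreal (\<theta> ?c))"
        using le[of "f x" ?c] ab \<theta>(2)
        by (simp add: ennreal_mult[symmetric] ennreal_plus[symmetric] ennreal_leI del: ennreal_plus)
    qed
  qed
  then have ae: "AE y in M. G y (\<phi> (f y)) \<le> ?R (f y) y"
  proof eventually_elim
    case (elim y)
    have 1: "continuous_on UNIV (\<lambda>c. G y (\<phi> c))"
      by (rule continuous_on_compose2[OF contGK(1) cont(1)]) auto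
    have 2: "continuous_on UNIV (\<lambda>c. ?R c y)"
      by (intro continuous_on_add_ennreal ennreal_continuous_on_cmult continuous_on_ennreal continuous_on_const cont contGK)
        (auto simp: top.not_eq_extremum)
    show ?case using continuous_le_if_le_rat[OF 1 2] elim by blast
  qed
  have "increment_integral M T p (\<lambda>x. \<phi> (f x)) = (\<integral>\<^sup>+y. G y (\<phi> (f y)) \<partial>M)"
    by (rule increment_integral_eq[OF G])
  also have "\<dots> \<le> (\<integral>\<^sup>+y. ?R (f y) y \<partial>M)"
    using ae by (rule nn_integral_mono_AE)
  also have "\<dots> = ennreal a * (\<integral>\<^sup>+y. K y (f y) \<partial>M) +
      ennreal b * ((\<integral>\<^sup>+y. ennreal (T (\<lambda>x. \<theta> (f x)) y) \<partial>M) + (\<integral>\<^sup>+y. ennreal (\<theta> (f y)) \<partial>M))"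
    by (simp add: nn_integral_add nn_integral_cmult)
  also have "(\<integral>\<^sup>+y. ennreal (T (\<lambda>x. \<theta> (f x)) y) \<partial>M) = (\<integral>\<^sup>+y. ennreal (\<theta> (f y)) \<partial>M)"
    using nn_integral_T[OF \<theta>(1)] \<theta>(2) by simp
  also have "(\<integral>\<^sup>+y. K y (f y) \<partial>M) = increment_integral M T q f"
    by (rule increment_integral_eq[OF K, symmetric])
  also have "ennreal b * ((\<integral>\<^sup>+y. ennreal (\<theta> (f y)) \<partial>M) + (\<integral>\<^sup>+y. ennreal (\<theta> (f y)) \<partial>M)) =
      ennreal (2 * b) * (\<integral>\<^sup>+y. ennreal (\<theta> (f y)) \<partial>M)"
    using ab by (simp add: mult_2[symmetric] ennreal_mult mult.assoc mult.left_commute)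
  finally show ?thesis .
qed

text \<open>
  The identity \<open>T \<bar>f - c\<bar>\<^sup>2 = T f\<^sup>2 - 2 c T f + c\<^sup>2\<close> is established for nonnegative functions only,
  hence with all negative terms moved to the other side.
\<close>

lemma increment_integral_2:
  assumes f: "f \<in> Lp M 2"
  shows "increment_integral M T 2 f = ennreal (2 * (L2_inner M f f - L2_inner M (T f) f))"
proof -
  obtain G where G: "continuous_version M T 2 f G"
    using continuous_version_exists[OF f] by auto
  have [measurable]: "f \<in> borel_measurable M" "T f \<in> borel_measurable M"
    using f Lp_measurable measurable_T by blast+
  have int: "integrable M (\<lambda>x. f x * f x)" "integrable M (\<lambda>x. T f x * f x)"
    using L2_mult_integrable[OF f f] L2_mult_integrable[OF L2[OF f] f] .
  obtain Q where Q: "positive_ext M T (\<lambda>x. ennreal (f x * f x)) Q"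
    using positive_ext_exists[OF f, of "\<lambda>s. s * s"] by auto
  have Qint: "(\<integral>\<^sup>+x. Q x \<partial>M) = ennreal (L2_inner M f f)"
    using nn_integral_positive_ext[OF f, of "\<lambda>s. s * s", OF _ _ _ _ Q] int(1)
    by (simp add: nn_integral_eq_integral L2_inner_def)
  have [measurable]: "Q \<in> borel_measurable M" using Q by (simp add: positive_ext_def)
  have Qfin: "AE x in M. Q x < \<infinity>"
    using nn_integral_noteq_infinite[of Q M] Qint by (auto simp: top.not_eq_extremum)
  define fp where "fp x = max (f x) 0" for x
  define fm where "fm x = max (- f x) 0" for x
  have fpm: "fp \<in> Lp M 2" "fm \<in> Lp M 2"
    by (auto intro!: L2_bound[OF f] simp: fp_def[abs_def] fm_def[abs_def])
  have fpm0: "AE x in M. 0 \<le> fp x" "AE x in M. 0 \<le> fm x"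
    by (auto simp: fp_def fm_def)
  have decomp: "f = (\<lambda>x. fp x + (-1) * fm x)" by (auto simp: fp_def fm_def max_def)
  have Tf: "AE x in M. T f x = T fp x - T fm x"
  proof -
    have "AE x in M. T f x = T fp x + T (\<lambda>x. (-1) * fm x) x"
      using add[OF fpm(1) L2_scale[OF fpm(2), of "-1"]] unfolding decomp[symmetric] .
    with scale[OF fpm(2), of "-1"] show ?thesis by eventually_elim simp
  qed
  \<comment> \<open>The explicit quadratic polynomial in \<open>c\<close> with which
    \<open>G y\<close> is identified, first at rational \<open>c\<close> and then, by continuity, at
    \<open>c = f y\<close>.\<close>
  define D where "D y c = c * c - 2 * c * T f y + enn2real (Q y)" for y c
  have "AE y in M. \<forall>r. 0 \<le> D y (real_of_rat r) \<and> ennreal (D y (real_of_rat r)) = G y (real_of_rat r)"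
    unfolding AE_all_countable
  proof
    fix r
    define c where "c = real_of_rat r"
    define cp where "cp = max c 0"
    define cm where "cm = max (- c) 0"
    have cpm: "0 \<le> cp" "0 \<le> cm" "c = cp - cm" by (auto simp: cp_def cm_def max_def)
    have GE: "positive_ext M T (\<lambda>x. ennreal (\<bar>f x - c\<bar> powr 2)) (\<lambda>y. G y c)"
      using G by (simp add: continuous_version_def)
    note p = positive_ext_L2[OF fpm(1) fpm0(1)] and m = positive_ext_L2[OF fpm(2) fpm0(2)]
    have 1: "positive_ext M T (\<lambda>x. ennreal (\<bar>f x - c\<bar> powr 2) +
          (ennreal (2 * cp) * ennreal (fp x) + ennreal (2 * cm) * ennreal (fm x)))
        (\<lambda>y. G y c + (ennreal (2 * cp) * ennreal (T fp y) + ennreal (2 * cm) * ennreal (T fm y)))"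
      by (intro positive_ext_add positive_ext_cmult GE p m)
    have 2: "positive_ext M T (\<lambda>x. (ennreal (f x * f x) + ennreal (c * c)) +
          (ennreal (2 * cp) * ennreal (fm x) + ennreal (2 * cm) * ennreal (fp x)))
        (\<lambda>y. (Q y + ennreal (c * c)) + (ennreal (2 * cp) * ennreal (T fm y) + ennreal (2 * cm) * ennreal (T fp y)))"
      by (intro positive_ext_add positive_ext_cmult positive_ext_const Q p m)
    have "ennreal (\<bar>f x - c\<bar> powr 2) +
          (ennreal (2 * cp) * ennreal (fp x) + ennreal (2 * cm) * ennreal (fm x)) =
        (ennreal (f x * f x) + ennreal (c * c)) +
          (ennreal (2 * cp) * ennreal (fm x) + ennreal (2 * cm) * ennreal (fp x))" for x
    proof -
      have pm: "0 \<le> fp x" "0 \<le> fm x" "f x = fp x - fm x" by (auto simp: fp_def fm_def max_def)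
      have "\<bar>f x - c\<bar> powr 2 + (2 * cp * fp x + 2 * cm * fm x) =
          f x * f x + c * c + (2 * cp * fm x + 2 * cm * fp x)"
        unfolding pm(3) cpm(3) by (simp add: power2_eq_square algebra_simps)
      then show ?thesis using cpm(1,2) pm(1,2)
        by (simp add: ennreal_mult[symmetric] ennreal_plus[symmetric] del: ennreal_plus)
    qed
    then have "AE y in M. G y c + (ennreal (2 * cp) * ennreal (T fp y) + ennreal (2 * cm) * ennreal (T fm y)) =
        (Q y + ennreal (c * c)) + (ennreal (2 * cp) * ennreal (T fm y) + ennreal (2 * cm) * ennreal (T fp y))"
      using positive_ext_unique[OF 1] 2 by simp
    then show "AE y in M. 0 \<le> D y c \<and> ennreal (D y c) = G y c"
      using Qfin Tf T_nonneg[OF fpm(1) fpm0(1)] T_nonneg[OF fpm(2) fpm0(2)]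
    proof eventually_elim
      case (elim y)
      obtain q where q: "Q y = ennreal q" "0 \<le> q" using elim(2) by (cases "Q y") auto
      define A where "A = 2 * cp * T fp y + 2 * cm * T fm y"
      define B where "B = q + c * c + (2 * cp * T fm y + 2 * cm * T fp y)"
      have AB: "0 \<le> A" "0 \<le> B" using cpm(1,2) elim(4,5) q(2) by (auto simp: A_def B_def)
      have eq: "G y c + ennreal A = ennreal B"
        using elim(1,4,5) cpm(1,2) q
        by (simp add: A_def B_def ennreal_mult[symmetric] ennreal_plus[symmetric] del: ennreal_plus)
      have "G y c \<le> ennreal B" unfolding eq[symmetric] by simp
      then obtain d where d: "G y c = ennreal d" "0 \<le> d" by (cases "G y c") (auto simp: top_unique)
      have "ennreal (d + A) = ennreal B" using eq d AB by simp
      then have "d + A = B" using AB d(2) by (subst (asm) ennreal_inj) auto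
      then have "d = c * c - 2 * c * T f y + q"
        unfolding A_def B_def elim(3) cpm(3) by (simp add: algebra_simps)
      then show ?case using d q by (simp add: D_def)
    qed
  qed
  then have D: "AE y in M. 0 \<le> D y (f y) \<and> G y (f y) = ennreal (D y (f y))"
  proof eventually_elim
    case (elim y)
    have 1: "continuous_on UNIV (D y)" unfolding D_def by (intro continuous_intros)
    have 2: "continuous_on UNIV (\<lambda>c. ennreal (D y c))" by (intro continuous_on_ennreal 1)
    have 3: "continuous_on UNIV (G y)" using G by (simp add: continuous_version_def)
    have "0 \<le> D y (f y)"
      by (rule continuous_le_if_le_rat[OF continuous_on_const 1]) (use elim in blast)
    moreover have "G y (f y) = ennreal (D y (f y))"
      by (rule antisym; rule continuous_le_if_le_rat[OF 3 2] continuous_le_if_le_rat[OF 2 3]) (use elim in simp_all)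
    ultimately show ?case by blast
  qed
  have Q': "AE x in M. Q x = ennreal (enn2real (Q x))"
    using Qfin by eventually_elim simp
  have "(\<integral>\<^sup>+x. ennreal (enn2real (Q x)) \<partial>M) = ennreal (L2_inner M f f)"
    unfolding Qint[symmetric] using Q' by (intro nn_integral_cong_AE) (auto elim: eventually_mono)
  moreover have "0 \<le> L2_inner M f f" unfolding L2_inner_def by (rule integral_nonneg_AE) simp
  \<comment> \<open>\<open>Q\<close> has integral \<open>L2_inner M f f\<close> by preservation of
    mass. This is the second copy of the squared norm and explains the factor 2 in the
    result.\<close>
  ultimately have "has_bochner_integral M (\<lambda>x. enn2real (Q x)) (L2_inner M f f)"
    by (intro has_bochner_integral_nn_integral) auto
  then have hD: "has_bochner_integral M (\<lambda>y. f y * f y - 2 * (T f y * f y) + enn2real (Q y))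
      (L2_inner M f f - 2 * L2_inner M (T f) f + L2_inner M f f)"
    using int unfolding L2_inner_def
    by (intro has_bochner_integral_add has_bochner_integral_diff has_bochner_integral_mult_right
        has_bochner_integral_integrable)
  have D_eq: "D y (f y) = f y * f y - 2 * (T f y * f y) + enn2real (Q y)" for y
    by (simp add: D_def)
  have "increment_integral M T 2 f = (\<integral>\<^sup>+y. G y (f y) \<partial>M)"
    by (rule increment_integral_eq[OF G])
  also have "\<dots> = (\<integral>\<^sup>+y. ennreal (D y (f y)) \<partial>M)"
    using D by (intro nn_integral_cong_AE) (auto elim: eventually_mono)
  also have "\<dots> = ennreal (LINT y|M. D y (f y))"
    using D hD by (intro nn_integral_eq_integral) (auto elim: eventually_mono simp: D_eq has_bochner_integral_iff)
  also have "(LINT y|M. D y (f y)) = 2 * (L2_inner M f f - L2_inner M (T f) f)"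
    using hD by (simp add: D_eq has_bochner_integral_iff)
  finally show ?thesis .
qed

end

section \<open>Energies along the semigroup and resolvents of the form\<close>

text \<open>Serves both the Cauchy-Schwarz inequality and the estimate for almost minimizers in
  \<open>resolvent_exists\<close>.\<close>

lemma quadratic_nonneg_discriminant:
  fixes a b c :: real
  assumes nonneg: "\<And>r. 0 \<le> a + 2 * r * b + r * r * c" and "0 \<le> c"
  shows "b * b \<le> a * c"
proof (cases "c = 0")
  case True
  have "b = 0"
  proof (rule ccontr)
    assume "b \<noteq> 0"
    then show False using nonneg[of "- (a + 1) / (2 * b)"] True by (simp add: field_simps)
  qed
  then show ?thesis using True by simp
next
  case False
  then have "c > 0" using assms(2) by simp
  have "0 \<le> (a + 2 * (- b / c) * b + (- b / c) * (- b / c) * c) * c"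
    using nonneg[of "- b / c"] \<open>c > 0\<close> by (intro mult_nonneg_nonneg) auto
  also have "\<dots> = a * c - b * b" using \<open>c > 0\<close> by (simp add: field_simps)
  finally show ?thesis by simp
qed

text \<open>The bilinear forms act on functions and not on classes modulo null sets, so they are
  only semidefinite. The same algebra is used for \<open>L2_inner M\<close> on \<open>Lp M 2\<close>
  and for \<open>form1\<close> on \<open>F\<close>.\<close>

locale semidefinite_form =
  fixes V :: "('a \<Rightarrow> real) set" and Q :: "('a \<Rightarrow> real) \<Rightarrow> ('a \<Rightarrow> real) \<Rightarrow> real"
  assumes V_add: "\<And>f g. f \<in> V \<Longrightarrow> g \<in> V \<Longrightarrow> (\<lambda>x. f x + g x) \<in> V"
    and V_scale: "\<And>f c. f \<in> V \<Longrightarrow> (\<lambda>x. c * f x) \<in> V"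
    and Q_add: "\<And>f g h. f \<in> V \<Longrightarrow> g \<in> V \<Longrightarrow> h \<in> V \<Longrightarrow> Q (\<lambda>x. f x + g x) h = Q f h + Q g h"
    and Q_scale: "\<And>f h c. f \<in> V \<Longrightarrow> h \<in> V \<Longrightarrow> Q (\<lambda>x. c * f x) h = c * Q f h"
    and Q_sym: "\<And>f g. f \<in> V \<Longrightarrow> g \<in> V \<Longrightarrow> Q f g = Q g f"
    and Q_nonneg: "\<And>f. f \<in> V \<Longrightarrow> 0 \<le> Q f f"
begin

lemma V_diff: "f \<in> V \<Longrightarrow> g \<in> V \<Longrightarrow> (\<lambda>x. f x - g x) \<in> V"
  using V_add[OF _ V_scale[of g "-1"]] by simp

lemma Q_diff: "f \<in> V \<Longrightarrow> g \<in> V \<Longrightarrow> h \<in> V \<Longrightarrow> Q (\<lambda>x. f x - g x) h = Q f h - Q g h"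
  using Q_add[OF _ V_scale[of g "-1"], of f h] Q_scale[of g h "-1"] by simp

lemma Q_expand:
  assumes "f \<in> V" "g \<in> V"
  shows "Q (\<lambda>x. f x + r * g x) (\<lambda>x. f x + r * g x) = Q f f + 2 * r * Q f g + r * r * Q g g"
proof -
  note rg = V_scale[OF assms(2), of r]
  note frg = V_add[OF assms(1) rg]
  have "Q (\<lambda>x. f x + r * g x) (\<lambda>x. f x + r * g x) = Q (\<lambda>x. f x + r * g x) f + r * Q (\<lambda>x. f x + r * g x) g"
    using Q_add[OF assms(1) rg frg] Q_scale[OF assms(2) frg, of r]
      Q_sym[OF assms(1) frg] Q_sym[OF assms(2) frg] by simp
  also have "\<dots> = Q f f + 2 * r * Q f g + r * r * Q g g"
    using Q_add[OF assms(1) rg assms(1)] Q_add[OF assms(1) rg assms(2)]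
      Q_scale[OF assms(2) assms(1), of r] Q_scale[OF assms(2) assms(2), of r] Q_sym[OF assms]
    by (simp add: algebra_simps)
  finally show ?thesis .
qed

lemma Q_expand_diff:
  assumes "f \<in> V" "g \<in> V"
  shows "Q (\<lambda>x. f x - g x) (\<lambda>x. f x - g x) = Q f f - 2 * Q f g + Q g g"
  using Q_expand[OF assms, of "-1"] by simp

lemma Q_cauchy_schwarz_sq:
  assumes "f \<in> V" "g \<in> V"
  shows "Q f g * Q f g \<le> Q f f * Q g g"
proof (rule quadratic_nonneg_discriminant)
  show "0 \<le> Q f f + 2 * r * Q f g + r * r * Q g g" for r
    using Q_expand[OF assms, of r] Q_nonneg[OF V_add[OF assms(1) V_scale[OF assms(2), of r]]] by simp
qed (rule Q_nonneg[OF assms(2)])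

lemma Q_cauchy_schwarz:
  assumes "f \<in> V" "g \<in> V"
  shows "\<bar>Q f g\<bar> \<le> sqrt (Q f f) * sqrt (Q g g)"
proof -
  have "\<bar>Q f g\<bar> = sqrt (Q f g * Q f g)" by (metis real_sqrt_abs2)
  also have "\<dots> \<le> sqrt (Q f f * Q g g)"
    using Q_cauchy_schwarz_sq[OF assms] by (rule real_sqrt_le_mono)
  finally show ?thesis by (simp add: real_sqrt_mult)
qed

end

interpretation L2_form: semidefinite_form "Lp M 2" "L2_inner M" for M :: "'a measure"
proof
  fix f g h :: "'a \<Rightarrow> real" and c :: real
  show "f \<in> Lp M 2 \<Longrightarrow> g \<in> Lp M 2 \<Longrightarrow> (\<lambda>x. f x + g x) \<in> Lp M 2" by (rule L2_add)
  show "f \<in> Lp M 2 \<Longrightarrow> (\<lambda>x. c * f x) \<in> Lp M 2" by (rule L2_scale)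
  show "f \<in> Lp M 2 \<Longrightarrow> g \<in> Lp M 2 \<Longrightarrow> h \<in> Lp M 2 \<Longrightarrow>
      L2_inner M (\<lambda>x. f x + g x) h = L2_inner M f h + L2_inner M g h"
    unfolding L2_inner_def distrib_right
    by (rule Bochner_Integration.integral_add) (auto intro: L2_mult_integrable)
  show "L2_inner M (\<lambda>x. c * f x) h = c * L2_inner M f h"
    unfolding L2_inner_def mult.assoc by simp
  show "L2_inner M f g = L2_inner M g f"
    unfolding L2_inner_def by (simp add: mult.commute)
  show "0 \<le> L2_inner M f f"
    unfolding L2_inner_def by (rule integral_nonneg_AE) simp
qed

lemma L2_inner_cong_AE:
  assumes "f \<in> Lp M 2" "f' \<in> Lp M 2" "g \<in> Lp M 2" "AE x in M. f x = f' x"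
  shows "L2_inner M f g = L2_inner M f' g"
  unfolding L2_inner_def
proof (rule integral_cong_AE)
  have [measurable]: "f \<in> borel_measurable M" "f' \<in> borel_measurable M" "g \<in> borel_measurable M"
    using assms(1-3) by (simp_all add: Lp_measurable)
  show "(\<lambda>x. f x * g x) \<in> borel_measurable M" "(\<lambda>x. f' x * g x) \<in> borel_measurable M"
    by measurable
  show "AE x in M. f x * g x = f' x * g x"
    using assms(4) by eventually_elim simp
qed

lemma L2_inner_self_eq_0:
  assumes "f \<in> Lp M 2" "L2_inner M f f = 0"
  shows "AE x in M. f x = 0"
proof -
  have "AE x in M. f x * f x = 0"
    using assms integral_nonneg_eq_0_iff_AE[of M "\<lambda>x. f x * f x"]
    by (simp add: L2_inner_def Lp_2_iff)
  then show ?thesis by eventually_elim simp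
qed

text \<open>Inner regularity yields a compact subset of positive measure; finitely many open sets of
  finite measure cover it.\<close>

lemma radon_semifinite:
  assumes "radon_measure M" "A \<in> sets M" "emeasure M A \<noteq> 0"
  shows "\<exists>B\<in>sets M. B \<subseteq> A \<and> emeasure M B \<noteq> 0 \<and> emeasure M B < \<infinity>"
proof -
  have "emeasure M A = (SUP K\<in>{K. K \<subseteq> A \<and> compact K \<and> K \<in> sets M}. emeasure M K)"
    using assms(1,2) unfolding radon_measure_def by blast
  then have "0 < (SUP K\<in>{K. K \<subseteq> A \<and> compact K \<and> K \<in> sets M}. emeasure M K)"
    using assms(3) by (simp add: zero_less_iff_neq_zero)
  then obtain K where K: "K \<subseteq> A" "compact K" "K \<in> sets M" "0 < emeasure M K"
    unfolding less_SUP_iff by blast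
  define \<U> where "\<U> = {U. open U \<and> emeasure M U < \<infinity>}"
  have fin: "\<forall>x. \<exists>U. open U \<and> x \<in> U \<and> emeasure M U < \<infinity>" and M: "sets M = sets borel"
    using assms(1) unfolding radon_measure_def by blast+
  then have "K \<subseteq> \<Union>\<U>" unfolding \<U>_def by blast
  moreover have "\<And>U. U \<in> \<U> \<Longrightarrow> open U" by (simp add: \<U>_def)
  ultimately obtain C where C: "C \<subseteq> \<U>" "finite C" "K \<subseteq> \<Union>C"
    using compactE[OF K(2), of \<U>] by blast
  have CM: "C \<subseteq> sets M" using C(1) M by (auto simp: \<U>_def)
  have "emeasure M K \<le> emeasure M (\<Union>C)"
    using C(3) by (rule emeasure_mono) (rule sets.finite_Union[OF C(2) CM])
  also have "emeasure M (\<Union>C) \<le> (\<Sum>U\<in>C. emeasure M U)"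
    using emeasure_subadditive_finite[OF C(2), of "\<lambda>U. U" M] CM unfolding image_ident by blast
  also have "(\<Sum>U\<in>C. emeasure M U) < \<infinity>"
  proof -
    have "\<And>U. U \<in> C \<Longrightarrow> emeasure M U < top" using C(1) by (auto simp: \<U>_def)
    then show ?thesis using C(2) by simp
  qed
  finally have "emeasure M K < \<infinity>" .
  moreover have "emeasure M K \<noteq> 0" using K(4) by simp
  ultimately show ?thesis using K(1,3) by blast
qed

lemma conservative_operator_semigroup:
  assumes "radon_measure M" "markovian_semigroup M P" "conservative M P" "0 \<le> t"
  shows "conservative_operator M (P t)"
proof -
  interpret markovian_semigroup M P by fact
  show ?thesis
  proof
    show "\<exists>B\<in>sets M. B \<subseteq> A \<and> emeasure M B \<noteq> 0 \<and> emeasure M B < \<infinity>"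
      if "A \<in> sets M" "emeasure M A \<noteq> 0" for A
      by (rule radon_semifinite[OF assms(1) that])
    show "positive_ext M (P t) (\<lambda>_. 1) (\<lambda>_. 1)"
      using assms(3,4) by (simp add: conservative_def)
  qed (fact maps_L2[OF assms(4)] add[OF assms(4)] scale[OF assms(4)] symmetric[OF assms(4)]
      markovian[OF assms(4)])+
qed

section \<open>Growth of the energy in time\<close>

context markovian_semigroup
begin

definition energy :: "real \<Rightarrow> ('a \<Rightarrow> real) \<Rightarrow> real" where
  "energy t f = L2_inner M f f - L2_inner M (P t f) f"

text \<open>The semigroup law and symmetry move one factor \<open>P t\<close> across. The energy at
  time \<open>2 * t\<close> is thus the squared norm of \<open>f\<close> minus that of
  \<open>P t f\<close>: contraction makes it nonnegative, and it never exceeds the squared norm of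
  \<open>f\<close>.\<close>

lemma inner_P_double:
  assumes "f \<in> Lp M 2" "0 \<le> t"
  shows "L2_inner M (P (2 * t) f) f = L2_inner M (P t f) (P t f)"
proof -
  note Pf = maps_L2[OF assms(2,1)]
  have "AE x in M. P (2 * t) f x = P t (P t f) x"
    unfolding mult_2 by (rule semigroup[OF assms(2,2,1)])
  moreover have "P (2 * t) f \<in> Lp M 2"
    using assms by (intro maps_L2) simp_all
  ultimately have "L2_inner M (P (2 * t) f) f = L2_inner M (P t (P t f)) f"
    by (intro L2_inner_cong_AE maps_L2[OF assms(2) Pf] assms(1))
  then show ?thesis using symmetric[OF assms(2) Pf assms(1)] by simp
qed

lemma energy_double:
  assumes "f \<in> Lp M 2" "0 \<le> t"
  shows "L2_inner M (\<lambda>x. P t f x - f x) (\<lambda>x. P t f x - f x) = 2 * energy t f - energy (2 * t) f"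
  using L2_form.Q_expand_diff[OF maps_L2[OF assms(2,1)] assms(1)] inner_P_double[OF assms]
  by (simp add: energy_def)

lemma energy_double_le:
  assumes "f \<in> Lp M 2" "0 \<le> t"
  shows "energy (2 * t) f \<le> 2 * energy t f"
  using energy_double[OF assms] L2_form.Q_nonneg[OF L2_diff[OF maps_L2[OF assms(2,1)] assms(1)]] by simp

lemma energy_nonneg:
  assumes "f \<in> Lp M 2" "0 \<le> t"
  shows "0 \<le> energy t f"
  using inner_P_double[OF assms(1), of "t / 2"] contraction[of "t / 2", OF _ assms(1)] assms(2)
  by (simp add: energy_def L2_norm_def)

lemma energy_le:
  assumes "f \<in> Lp M 2" "0 \<le> t"
  shows "energy t f \<le> L2_inner M f f"
  using inner_P_double[OF assms(1), of "t / 2"] L2_form.Q_nonneg[OF maps_L2[of "t / 2", OF _ assms(1)]] assms(2)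
  by (simp add: energy_def)

lemma energy_dyadic:
  assumes "f \<in> Lp M 2" "0 \<le> t"
  shows "energy t f \<le> 2 ^ n * energy (t / 2 ^ n) f"
proof (induction n)
  case (Suc n)
  have "energy (t / 2 ^ n) f \<le> 2 * energy (t / 2 ^ Suc n) f"
    using energy_double_le[OF assms(1), of "t / 2 ^ Suc n"] assms(2) by simp
  then have "2 ^ n * energy (t / 2 ^ n) f \<le> 2 ^ n * (2 * energy (t / 2 ^ Suc n) f)"
    by (rule mult_left_mono) simp
  also have "\<dots> = 2 ^ Suc n * energy (t / 2 ^ Suc n) f" by simp
  finally show ?case using Suc by linarith
qed simp

lemma fixed_if_energy_superlinear:
  assumes f: "f \<in> Lp M 2" and \<beta>: "1 < \<beta>" and le: "\<And>t. 0 < t \<Longrightarrow> energy t f \<le> C * t powr \<beta>" and t: "0 < t"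
  shows "AE x in M. P t f x = f x"
proof -
  have "energy t f \<le> C * t powr \<beta> * (2 powr (1 - \<beta>)) ^ n" for n
  proof -
    have "energy t f \<le> 2 ^ n * energy (t / 2 ^ n) f"
      using energy_dyadic[OF f] t by simp
    also have "\<dots> \<le> 2 ^ n * (C * (t / 2 ^ n) powr \<beta>)"
      using le[of "t / 2 ^ n"] t by (intro mult_left_mono) auto
    also have "\<dots> = C * t powr \<beta> * (2 ^ n / (2 ^ n) powr \<beta>)"
      using t by (simp add: powr_divide)
    also have "2 ^ n / (2 ^ n) powr \<beta> = ((2::real) ^ n) powr (1 - \<beta>)"
      by (simp add: powr_diff)
    also have "\<dots> = (2 powr (1 - \<beta>)) ^ n"
      by (simp add: powr_realpow[symmetric] powr_powr mult.commute)
    finally show ?thesis .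
  qed
  moreover have "(\<lambda>n. C * t powr \<beta> * (2 powr (1 - \<beta>)) ^ n) \<longlonglongrightarrow> C * t powr \<beta> * 0"
  proof (intro tendsto_mult_left LIMSEQ_power_zero)
    have "(2::real) powr (1 - \<beta>) < 2 powr 0" using \<beta> by (intro powr_less_mono) auto
    then show "norm ((2::real) powr (1 - \<beta>)) < 1" by simp
  qed
  ultimately have "energy t f \<le> 0" by (intro LIMSEQ_le_const[where X="\<lambda>n. C * t powr \<beta> * (2 powr (1 - \<beta>)) ^ n"]) auto
  \<comment> \<open>In \<open>energy_double\<close> the first term is now at most 0, and the
    subtracted energy at time \<open>2 * t\<close> is nonnegative.\<close>
  then have "L2_inner M (\<lambda>x. P t f x - f x) (\<lambda>x. P t f x - f x) \<le> 0"
    using energy_double[OF f, of t] energy_nonneg[OF f, of "2 * t"] t by simp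
  moreover have d: "(\<lambda>x. P t f x - f x) \<in> Lp M 2"
    using L2_diff[OF maps_L2[OF _ f] f] t by simp
  ultimately have "L2_inner M (\<lambda>x. P t f x - f x) (\<lambda>x. P t f x - f x) = 0"
    using L2_form.Q_nonneg[OF d] by simp
  from L2_inner_self_eq_0[OF d this] show ?thesis by (auto elim: eventually_mono)
qed

text \<open>The quotient \<open>energy t u / t\<close> tends to \<open>- L2_inner M w u\<close>,
  which bounds it for small \<open>t\<close>; \<open>energy_dyadic\<close> carries the same constant
  to all \<open>t\<close>. In \<open>C\<close>, the summand \<open>L2_norm M u\<close> pays, by
  Cauchy-Schwarz, for an error of norm below 1 in the difference quotient.\<close>

lemma energy_linear:
  assumes u: "u \<in> Lp M 2" and w: "w \<in> Lp M 2"
    and lim: "((\<lambda>t. L2_norm M (\<lambda>x. (P t u x - u x) / t - w x)) \<longlongrightarrow> 0) (at_right 0)"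
  shows "\<exists>C\<ge>0. \<forall>t>0. energy t u \<le> C * t"
proof -
  define C where "C = \<bar>L2_inner M w u\<bar> + L2_norm M u"
  have "0 \<le> L2_norm M u" using L2_form.Q_nonneg[OF u] by (simp add: L2_norm_def)
  then have "0 \<le> C" by (simp add: C_def)
  have "\<forall>\<^sub>F t in at_right 0. L2_norm M (\<lambda>x. (P t u x - u x) / t - w x) < 1"
    using order_tendstoD(2)[OF lim, of 1] by simp
  then obtain d where d: "0 < d" "\<And>t. 0 < t \<Longrightarrow> t < d \<Longrightarrow> L2_norm M (\<lambda>x. (P t u x - u x) / t - w x) < 1"
    unfolding eventually_at_right_field by auto
  have small: "energy t u \<le> C * t" if t: "0 < t" "t < d" for t
  proof -
    have Pu: "P t u \<in> Lp M 2" using maps_L2[OF _ u] t by simp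
    have q: "(\<lambda>x. (1 / t) * (P t u x - u x)) \<in> Lp M 2" by (intro L2_scale L2_diff Pu u)
    define e where "e x = (1 / t) * (P t u x - u x) - w x" for x
    have e: "e \<in> Lp M 2" unfolding e_def by (intro L2_diff[OF q w])
    have "L2_inner M e u = (1 / t) * (L2_inner M (P t u) u - L2_inner M u u) - L2_inner M w u"
      unfolding e_def
      by (simp only: L2_form.Q_diff[OF q w u] L2_form.Q_scale[OF L2_diff[OF Pu u] u] L2_form.Q_diff[OF Pu u u])
    then have "energy t u = t * (- L2_inner M w u - L2_inner M e u)"
      using t by (simp add: energy_def field_simps)
    also have "- L2_inner M w u - L2_inner M e u \<le> C"
    proof -
      have "\<bar>L2_inner M e u\<bar> \<le> L2_norm M e * L2_norm M u"
        unfolding L2_norm_def by (rule L2_form.Q_cauchy_schwarz[OF e u])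
      also have "L2_norm M e \<le> 1"
        using d(2)[OF t] by (simp add: e_def[abs_def])
      finally show ?thesis using \<open>0 \<le> L2_norm M u\<close> by (simp add: C_def mult_right_mono)
    qed
    finally show ?thesis using t by (simp add: mult.commute)
  qed
  have "energy t u \<le> C * t" if "0 < t" for t
  proof -
    obtain n where n: "t / d < 2 ^ n" using real_arch_pow[of 2 "t / d"] by auto
    then have "t / 2 ^ n < d" using d(1) by (simp add: field_simps)
    have "energy t u \<le> 2 ^ n * energy (t / 2 ^ n) u"
      using energy_dyadic[OF u] that by simp
    also have "\<dots> \<le> 2 ^ n * (C * (t / 2 ^ n))"
      using small[of "t / 2 ^ n"] \<open>t / 2 ^ n < d\<close> that by (intro mult_left_mono) auto
    finally show ?thesis by simp
  qed
  then show ?thesis using \<open>0 \<le> C\<close> by blast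
qed

end

section \<open>The Hilbert space of the form and its resolvent\<close>

context symmetric_dirichlet_form
begin

definition form1 :: "('a \<Rightarrow> real) \<Rightarrow> ('a \<Rightarrow> real) \<Rightarrow> real" where
  "form1 u v = E u v + L2_inner M u v"

lemma domain_in_L2: "f \<in> F \<Longrightarrow> f \<in> Lp M 2"
  using domain_L2 by blast

sublocale form1: semidefinite_form F form1
proof
  fix f g h :: "'a \<Rightarrow> real" and c :: real
  show "f \<in> F \<Longrightarrow> g \<in> F \<Longrightarrow> (\<lambda>x. f x + g x) \<in> F" by (rule domain_add)
  show "f \<in> F \<Longrightarrow> (\<lambda>x. c * f x) \<in> F" by (rule domain_scale)
  show "f \<in> F \<Longrightarrow> g \<in> F \<Longrightarrow> h \<in> F \<Longrightarrow> form1 (\<lambda>x. f x + g x) h = form1 f h + form1 g h"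
    by (simp add: form1_def form_add L2_form.Q_add domain_in_L2)
  show "f \<in> F \<Longrightarrow> h \<in> F \<Longrightarrow> form1 (\<lambda>x. c * f x) h = c * form1 f h"
    by (simp add: form1_def form_scale L2_form.Q_scale domain_in_L2 distrib_left)
  show "f \<in> F \<Longrightarrow> g \<in> F \<Longrightarrow> form1 f g = form1 g f"
    using form_sym[of f g] L2_form.Q_sym[of f M g] by (simp add: form1_def domain_in_L2)
  show "f \<in> F \<Longrightarrow> 0 \<le> form1 f f"
    using form_nonneg[of f] L2_form.Q_nonneg[of f M] by (simp add: form1_def domain_in_L2)
qed

lemma domain_norm_form1: "domain_norm M E f = sqrt (form1 f f)"
  by (simp add: domain_norm_def form1_def)

text \<open>
  The Riesz representation theorem in the Hilbert space \<open>(F, form1)\<close>, proved by minimizing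
  \<open>form1 u u - 2 \<langle>f, u\<rangle>\<close>.
\<close>

lemma resolvent_exists:
  assumes f: "f \<in> Lp M 2"
  shows "\<exists>u\<in>F. \<forall>v\<in>F. form1 u v = L2_inner M f v"
proof -
  define J where "J u = form1 u u - 2 * L2_inner M f u" for u
  have lower: "- L2_inner M f f \<le> J u" if "u \<in> F" for u
  proof -
    have "0 \<le> L2_inner M u u - 2 * L2_inner M u f + L2_inner M f f"
      using L2_form.Q_nonneg[OF L2_diff[OF domain_in_L2[OF that] f]]
        L2_form.Q_expand_diff[OF domain_in_L2[OF that] f] by simp
    then show ?thesis
      using form_nonneg[OF that] L2_form.Q_sym[OF domain_in_L2[OF that] f] by (simp add: J_def form1_def)
  qed
  define m where "m = (INF u\<in>F. J u)"
  have bdd: "bdd_below (J ` F)" using lower by (intro bdd_belowI2)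
  have m_le: "m \<le> J u" if "u \<in> F" for u
    unfolding m_def using that bdd by (rule cINF_lower[rotated])
  have "\<exists>u\<in>F. J u < m + 1 / real (Suc n)" for n
  proof -
    have "m < m + 1 / real (Suc n)" by simp
    then show ?thesis
      unfolding m_def using bdd domain_zero by (subst (asm) cINF_less_iff) auto
  qed
  then obtain u where u: "\<And>n. u n \<in> F" "\<And>n. J (u n) < m + 1 / real (Suc n)"
    by metis
  have inner_f_add: "L2_inner M f (\<lambda>x. a x + r * b x) = L2_inner M f a + r * L2_inner M f b"
    if "a \<in> F" "b \<in> F" for a b r
  proof -
    note ab = domain_in_L2[OF that(1)] domain_in_L2[OF that(2)]
    have "L2_inner M (\<lambda>x. a x + r * b x) f = L2_inner M a f + r * L2_inner M b f"
      using L2_form.Q_add[OF ab(1) L2_scale[OF ab(2)] f] L2_form.Q_scale[OF ab(2) f] by simp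
    then show ?thesis
      using L2_form.Q_sym[OF f] ab L2_add[OF ab(1) L2_scale[OF ab(2)]] by simp
  qed
  have J_expand: "J (\<lambda>x. a x + r * b x) = J a + 2 * r * (form1 a b - L2_inner M f b) + r * r * form1 b b"
    if "a \<in> F" "b \<in> F" for a b r
    using form1.Q_expand[OF that, of r] inner_f_add[OF that, of r] by (simp add: J_def algebra_simps)
  \<comment> \<open>Parallelogram argument: the value of \<open>J\<close> at the midpoint of
    \<open>u j\<close> and \<open>u k\<close> is at least \<open>m\<close>, while both end values
    exceed \<open>m\<close> by little. With \<open>d = u k - u j\<close> this gives
    \<open>form1 d d / 2 \<le> J (u j) + J (u k) - 2 * m\<close>.\<close>
  have cauchy: "form1 (\<lambda>x. u j x - u k x) (\<lambda>x. u j x - u k x) \<le> 2 / real (Suc j) + 2 / real (Suc k)" for j k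
  proof -
    define d where "d x = u k x - u j x" for x
    have dF: "d \<in> F" unfolding d_def by (rule form1.V_diff[OF u(1) u(1)])
    have uk: "u k = (\<lambda>x. u j x + 1 * d x)" by (simp add: d_def)
    have "J (u k) = J (u j) + 2 * (form1 (u j) d - L2_inner M f d) + form1 d d"
      using J_expand[OF u(1)[of j] dF, of 1, folded uk] by simp
    moreover have "m \<le> J (u j) + (form1 (u j) d - L2_inner M f d) + form1 d d / 4"
      using J_expand[OF u(1)[of j] dF, of "1 / 2"]
        m_le[OF form1.V_add[OF u(1)[of j] form1.V_scale[OF dF, of "1 / 2"]]] by simp
    moreover have "form1 (\<lambda>x. u j x - u k x) (\<lambda>x. u j x - u k x) = form1 d d"
    proof -
      have "(\<lambda>x. u j x - u k x) = (\<lambda>x. 0 * d x + (-1) * d x)" by (simp add: d_def)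
      then show ?thesis
        using form1.Q_expand[OF form1.V_scale[OF dF, of 0] dF, of "-1"]
          form1.Q_scale[OF dF dF, of 0] form1.Q_scale[OF dF form1.V_scale[OF dF, of 0], of 0] by simp
    qed
    ultimately show ?thesis using u(2)[of j] u(2)[of k] by simp
  qed
  have "\<exists>g\<in>F. (\<lambda>n. domain_norm M E (\<lambda>x. u n x - g x)) \<longlonglongrightarrow> 0"
  proof (rule closed[OF u(1)])
    fix e :: real assume "0 < e"
    then have "0 < e * e / 4" by simp
    then obtain N where N: "1 / real (Suc N) < e * e / 4" by (rule nat_approx_posE)
    have "domain_norm M E (\<lambda>x. u j x - u k x) < e" if "N \<le> j" "N \<le> k" for j k
    proof -
      have "1 / real (Suc j) \<le> 1 / real (Suc N)" "1 / real (Suc k) \<le> 1 / real (Suc N)"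
        using that by (auto intro!: divide_left_mono)
      then have "form1 (\<lambda>x. u j x - u k x) (\<lambda>x. u j x - u k x) < e * e"
        using cauchy[of j k] N by simp
      then have "sqrt (form1 (\<lambda>x. u j x - u k x) (\<lambda>x. u j x - u k x)) < sqrt (e * e)"
        by (rule real_sqrt_less_mono)
      then show ?thesis using \<open>0 < e\<close> by (simp add: domain_norm_form1)
    qed
    then show "\<exists>N. \<forall>m\<ge>N. \<forall>n\<ge>N. domain_norm M E (\<lambda>x. u m x - u n x) < e" by blast
  qed
  then obtain g where g: "g \<in> F" "(\<lambda>n. domain_norm M E (\<lambda>x. u n x - g x)) \<longlonglongrightarrow> 0" by blast
  have "form1 g v = L2_inner M f v" if v: "v \<in> F" for v
  proof -
    define a where "a n = form1 (u n) v - L2_inner M f v" for n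
    \<comment> \<open>Approximate Euler-Lagrange equation: \<open>J\<close> at
      \<open>u n + r * v\<close> is at least \<open>m\<close>, and
      \<open>J (u n) < m + 1 / (n + 1)\<close>, so the quadratic in \<open>r\<close> with constant
      term \<open>1 / (n + 1)\<close> is nonnegative.\<close>
    have "a n * a n \<le> 1 / real (Suc n) * form1 v v" for n
    proof (rule quadratic_nonneg_discriminant)
      show "0 \<le> 1 / real (Suc n) + 2 * r * a n + r * r * form1 v v" for r
        using J_expand[OF u(1)[of n] v, of r] u(2)[of n]
          m_le[OF form1.V_add[OF u(1)[of n] form1.V_scale[OF v, of r]]]
        by (simp add: a_def)
    qed (rule form1.Q_nonneg[OF v])
    then have a_le: "\<bar>a n\<bar> \<le> sqrt (1 / real (Suc n) * form1 v v)" for n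
      by (metis real_sqrt_abs2 real_sqrt_le_mono)
    have "(\<lambda>n. sqrt (1 / real (Suc n) * form1 v v)) \<longlonglongrightarrow> sqrt (0 * form1 v v)"
      by (intro tendsto_real_sqrt tendsto_mult_right lim_1_over_n[THEN LIMSEQ_Suc])
    then have "a \<longlonglongrightarrow> 0"
      by (intro Lim_null_comparison[of a "\<lambda>n. sqrt (1 / real (Suc n) * form1 v v)"]) (use a_le in auto)
    moreover have "(\<lambda>n. form1 (\<lambda>x. u n x - g x) v) \<longlonglongrightarrow> 0"
    proof (rule Lim_null_comparison)
      show "(\<lambda>n. domain_norm M E (\<lambda>x. u n x - g x) * sqrt (form1 v v)) \<longlonglongrightarrow> 0"
        using tendsto_mult_right[OF g(2), of "sqrt (form1 v v)"] by simp
      show "\<forall>\<^sub>F n in sequentially. norm (form1 (\<lambda>x. u n x - g x) v) \<le> domain_norm M E (\<lambda>x. u n x - g x) * sqrt (form1 v v)"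
        using form1.Q_cauchy_schwarz[OF form1.V_diff[OF u(1) g(1)] v] by (simp add: domain_norm_form1)
    qed
    ultimately have "(\<lambda>n. a n - form1 (\<lambda>x. u n x - g x) v) \<longlonglongrightarrow> 0 - 0"
      by (rule tendsto_diff)
    moreover have "a n - form1 (\<lambda>x. u n x - g x) v = form1 g v - L2_inner M f v" for n
      using form1.Q_diff[OF u(1) g(1) v] by (simp add: a_def)
    ultimately have "(\<lambda>n::nat. form1 g v - L2_inner M f v) \<longlonglongrightarrow> 0" by simp
    then show ?thesis by (simp add: LIMSEQ_const_iff)
  qed
  then show ?thesis using g(1) by blast
qed

lemma orthogonal_domain_AE_0:
  assumes h: "h \<in> Lp M 2" and orth: "\<And>v. v \<in> F \<Longrightarrow> L2_inner M h v = 0"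
  shows "AE x in M. h x = 0"
proof (rule L2_inner_self_eq_0[OF h])
  have "L2_inner M h h \<le> 0"
  proof (rule field_le_epsilon)
    fix e :: real assume "0 < e"
    have n0: "0 \<le> L2_norm M h" using L2_form.Q_nonneg[OF h] by (simp add: L2_norm_def)
    then have "0 < e / (L2_norm M h + 1)" using \<open>0 < e\<close> by simp
    from domain_dense[OF h this] obtain g where g: "g \<in> F" "L2_norm M (\<lambda>x. h x - g x) < e / (L2_norm M h + 1)"
      by blast
    have g2: "g \<in> Lp M 2" by (rule domain_in_L2[OF g(1)])
    note d = L2_diff[OF h g2]
    have "L2_inner M h h = L2_inner M (\<lambda>x. h x - g x) h"
      using L2_form.Q_diff[OF h g2 h] orth[OF g(1)] L2_form.Q_sym[OF h g2] by simp
    also have "\<dots> \<le> L2_norm M (\<lambda>x. h x - g x) * L2_norm M h"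
      using L2_form.Q_cauchy_schwarz[OF d h] by (simp add: L2_norm_def)
    also have "\<dots> \<le> e / (L2_norm M h + 1) * L2_norm M h"
      using g(2) n0 by (intro mult_right_mono) auto
    also have "\<dots> \<le> e" using n0 \<open>0 < e\<close> by (simp add: field_simps)
    finally show "L2_inner M h h \<le> 0 + e" by simp
  qed
  then show "L2_inner M h h = 0" using L2_form.Q_nonneg[OF h] by simp
qed

lemma form1_cong_AE:
  assumes "f \<in> F" "g \<in> F" "h \<in> F" "AE x in M. f x = g x"
  shows "form1 f h = form1 g h"
  using form_AE[OF assms] L2_inner_cong_AE[OF _ _ _ assms(4)] assms(1-3)[THEN domain_in_L2]
  by (simp add: form1_def)

text \<open>
  Were both \<open>u = R f\<close> and \<open>R u\<close> constant, for \<open>R\<close> the resolvent, they would be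
  proportional, and then so would \<open>f\<close> and \<open>u\<close> by injectivity of \<open>R\<close>.
\<close>

lemma nonconstant_resolvent:
  assumes f: "f \<in> Lp M 2" "\<not> ae_constant M f"
  shows "\<exists>u\<in>F. \<exists>h\<in>Lp M 2. \<not> ae_constant M u \<and> (\<forall>v\<in>F. form1 u v = L2_inner M h v)"
proof (rule ccontr)
  assume contr: "\<not> ?thesis"
  have inj: "AE x in M. h x = 0"
    if "u \<in> F" "h \<in> Lp M 2" "\<And>v. v \<in> F \<Longrightarrow> form1 u v = L2_inner M h v" "AE x in M. u x = 0" for u h
  proof (rule orthogonal_domain_AE_0[OF that(2)])
    fix v assume v: "v \<in> F"
    have "form1 u v = form1 (\<lambda>x. 0 * u x) v"
      using that(4) by (intro form1_cong_AE that(1) v domain_scale) auto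
    then show "L2_inner M h v = 0"
      using form1.Q_scale[OF that(1) v, of 0] that(3)[OF v] by simp
  qed
  obtain u where u: "u \<in> F" "\<And>v. v \<in> F \<Longrightarrow> form1 u v = L2_inner M f v"
    using resolvent_exists[OF f(1)] by blast
  note u2 = domain_in_L2[OF u(1)]
  obtain w where w: "w \<in> F" "\<And>v. v \<in> F \<Longrightarrow> form1 w v = L2_inner M u v"
    using resolvent_exists[OF u2] by blast
  obtain a where a: "AE x in M. u x = a" using contr u f(1) unfolding ae_constant_def by blast
  obtain b where b: "AE x in M. w x = b" using contr w u2 unfolding ae_constant_def by blast
  have b0: "b \<noteq> 0"
  proof
    assume "b = 0"
    then have "AE x in M. u x = 0" using inj[OF w(1) u2 w(2)] b by simp
    then have "AE x in M. f x = 0" using inj[OF u(1) f(1) u(2)] by simp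
    then show False using f(2) by (auto simp: ae_constant_def)
  qed
  \<comment> \<open>The resolvent sends \<open>h\<close> to \<open>b * u - a * w\<close>, which is
    zero almost everywhere because \<open>u = a\<close> and \<open>w = b\<close>. Then
    \<open>h = 0\<close> almost everywhere, and \<open>f\<close> is the constant
    \<open>a * a / b\<close>.\<close>
  define h where "h x = b * f x - a * u x" for x
  have hL: "h \<in> Lp M 2" unfolding h_def by (intro L2_diff L2_scale f u2)
  have "AE x in M. h x = 0"
  proof (rule orthogonal_domain_AE_0[OF hL])
    fix v assume v: "v \<in> F"
    note v2 = domain_in_L2[OF v]
    have "AE x in M. b * u x = a * w x" using a b by eventually_elim simp
    then have "form1 (\<lambda>x. b * u x) v = form1 (\<lambda>x. a * w x) v"
      by (intro form1_cong_AE domain_scale u w v)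
    then have "b * L2_inner M f v = a * L2_inner M u v"
      using form1.Q_scale[OF u(1) v] form1.Q_scale[OF w(1) v] u(2)[OF v] w(2)[OF v] by simp
    then show "L2_inner M h v = 0"
      unfolding h_def
      using L2_form.Q_diff[OF L2_scale[OF f(1)] L2_scale[OF u2] v2, of b a]
        L2_form.Q_scale[OF f(1) v2, of b] L2_form.Q_scale[OF u2 v2, of a] by simp
  qed
  then have "AE x in M. f x = a * a / b"
    using a by eventually_elim (use b0 in \<open>simp add: h_def field_simps\<close>)
  then show False using f(2) by (auto simp: ae_constant_def)
qed

end

section \<open>Besov spaces and critical exponents\<close>

text \<open>Taking \<open>p\<close>-th powers removes the roots and the supremum. In this form the
  spaces for different exponents become comparable through the order in \<open>t\<close>
  alone.\<close>

lemma besov_space_iff: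
  assumes p: "1 \<le> p"
  shows "f \<in> besov_space M P p \<alpha> \<longleftrightarrow> f \<in> Lp M p \<and>
    (\<exists>C\<ge>0. \<forall>t>0. increment_integral M (P t) p f \<le> ennreal (C * t powr (p * \<alpha>)))"
proof -
  let ?I = "\<lambda>t. increment_integral M (P t) p f"
  have "besov_seminorm M P p \<alpha> f < \<infinity> \<longleftrightarrow> (\<exists>C\<ge>0. \<forall>t>0. ?I t \<le> ennreal (C * t powr (p * \<alpha>)))"
  proof
    assume "besov_seminorm M P p \<alpha> f < \<infinity>"
    then obtain s where s: "besov_seminorm M P p \<alpha> f = ennreal s" "0 \<le> s"
      by (cases "besov_seminorm M P p \<alpha> f") auto
    have "?I t \<le> ennreal (s powr p * t powr (p * \<alpha>))" if t: "0 < t" for t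
    proof -
      have le: "ennreal (t powr (- \<alpha>)) * ennreal_root p (?I t) \<le> ennreal s"
        unfolding s(1)[symmetric] besov_seminorm_def using t by (intro SUP_upper) auto
      have "?I t \<noteq> top"
      proof
        assume "?I t = top"
        then show False using le t by (simp add: ennreal_root_def ennreal_mult_top top_unique)
      qed
      then obtain i where i: "?I t = ennreal i" "0 \<le> i" by (cases "?I t") auto
      have "ennreal (t powr (- \<alpha>) * i powr (1 / p)) \<le> ennreal s"
        using le i by (simp add: ennreal_root_def ennreal_mult)
      then have "t powr (- \<alpha>) * i powr (1 / p) \<le> s" using s(2) by simp
      then have "t powr \<alpha> * (t powr (- \<alpha>) * i powr (1 / p)) \<le> t powr \<alpha> * s"
        by (rule mult_left_mono) simp
      then have "i powr (1 / p) \<le> t powr \<alpha> * s"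
        using t by (simp add: powr_minus field_simps)
      then have "(i powr (1 / p)) powr p \<le> (t powr \<alpha> * s) powr p"
        using p by (intro powr_mono2) auto
      then have "i \<le> s powr p * t powr (p * \<alpha>)"
        using p i(2) s(2) by (simp add: powr_powr powr_mult mult.commute)
      then show ?thesis unfolding i(1) by (rule ennreal_leI)
    qed
    then show "\<exists>C\<ge>0. \<forall>t>0. ?I t \<le> ennreal (C * t powr (p * \<alpha>))"
      by (intro exI[of _ "s powr p"]) simp
  next
    assume "\<exists>C\<ge>0. \<forall>t>0. ?I t \<le> ennreal (C * t powr (p * \<alpha>))"
    then obtain C where C: "0 \<le> C" "\<And>t. 0 < t \<Longrightarrow> ?I t \<le> ennreal (C * t powr (p * \<alpha>))" by blast
    have "besov_seminorm M P p \<alpha> f \<le> ennreal (C powr (1 / p))"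
      unfolding besov_seminorm_def
    proof (rule SUP_least)
      fix t :: real assume "t \<in> {0<..}"
      then have t: "0 < t" by simp
      have "?I t < top" using C(2)[OF t] le_less_trans ennreal_less_top by blast
      then obtain i where i: "?I t = ennreal i" "0 \<le> i" by (cases "?I t") auto
      have "i \<le> C * t powr (p * \<alpha>)" using C(2)[OF t] C(1) i by simp
      then have "i powr (1 / p) \<le> (C * t powr (p * \<alpha>)) powr (1 / p)"
        using p i(2) by (intro powr_mono2) auto
      also have "\<dots> = C powr (1 / p) * t powr \<alpha>"
        using p C(1) by (simp add: powr_mult powr_powr)
      finally have "t powr (- \<alpha>) * i powr (1 / p) \<le> t powr (- \<alpha>) * (C powr (1 / p) * t powr \<alpha>)"
        by (rule mult_left_mono) simp
      also have "\<dots> = C powr (1 / p)" using t by (simp add: powr_minus field_simps)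
      finally show "ennreal (t powr (- \<alpha>)) * ennreal_root p (?I t) \<le> ennreal (C powr (1 / p))"
        using i by (simp add: ennreal_root_def ennreal_mult[symmetric] ennreal_leI)
    qed
    then show "besov_seminorm M P p \<alpha> f < \<infinity>"
      using le_less_trans ennreal_less_top by (metis infinity_ennreal_def)
  qed
  then show ?thesis by (simp add: besov_space_def)
qed

text \<open>Outside a common null set the constants \<open>c n\<close> themselves converge to
  \<open>f x\<close>, so the limit does not depend on \<open>x\<close>.\<close>

lemma ae_constant_limit:
  assumes "\<And>n::nat. ae_constant M (h n)" "\<And>x. (\<lambda>n. h n x) \<longlonglongrightarrow> f x"
  shows "ae_constant M f"
proof -
  obtain c where c: "\<And>n. AE x in M. h n x = c n"
    using assms(1) unfolding ae_constant_def by metis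
  have "AE x in M. \<forall>n. h n x = c n" unfolding AE_all_countable using c by blast
  then have "AE x in M. f x = lim c"
  proof eventually_elim
    case (elim x)
    then have "c \<longlonglongrightarrow> f x" using assms(2)[of x] by simp
    then show ?case by (simp add: limI)
  qed
  then show ?thesis by (auto simp: ae_constant_def)
qed

lemma ae_constant_diff:
  assumes "ae_constant M f" "ae_constant M g"
  shows "ae_constant M (\<lambda>x. f x - g x)"
proof -
  obtain a b where "AE x in M. f x = a" "AE x in M. g x = b"
    using assms by (auto simp: ae_constant_def)
  then have "AE x in M. f x - g x = a - b" by eventually_elim simp
  then show ?thesis by (auto simp: ae_constant_def)
qed

text \<open>As the levels \<open>1 / (n + 1)\<close> decrease to 0, the two excesses tend to the
  positive and the negative part of \<open>f\<close>.\<close>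

lemma ae_constant_if_excesses_constant:
  assumes "\<And>n. ae_constant M (\<lambda>x. max (f x - 1 / real (Suc n)) 0)"
    "\<And>n. ae_constant M (\<lambda>x. max (- f x - 1 / real (Suc n)) 0)"
  shows "ae_constant M f"
proof (rule ae_constant_limit)
  show "ae_constant M (\<lambda>x. max (f x - 1 / real (Suc n)) 0 - max (- f x - 1 / real (Suc n)) 0)" for n
    by (rule ae_constant_diff[OF assms])
  fix x
  have "(\<lambda>n. max (f x - 1 / real (Suc n)) 0 - max (- f x - 1 / real (Suc n)) 0)
      \<longlonglongrightarrow> max (f x - 0) 0 - max (- f x - 0) 0"
    by (intro tendsto_diff tendsto_max tendsto_const lim_1_over_n[THEN LIMSEQ_Suc])
  then show "(\<lambda>n. max (f x - 1 / real (Suc n)) 0 - max (- f x - 1 / real (Suc n)) 0) \<longlonglongrightarrow> f x"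
    by (simp add: max_def split: if_splits)
qed

lemma ae_constant_if_truncations_constant:
  assumes "\<And>n. ae_constant M (\<lambda>x. max (- real (Suc n)) (min (f x) (real (Suc n))))"
  shows "ae_constant M f"
proof (rule ae_constant_limit[OF assms])
  fix x
  obtain N where N: "\<bar>f x\<bar> \<le> real N" using real_arch_simple by blast
  have "max (- real (Suc n)) (min (f x) (real (Suc n))) = f x" if "n \<ge> N" for n
  proof -
    have "\<bar>f x\<bar> \<le> real (Suc n)" using N that by linarith
    then show ?thesis by linarith
  qed
  then show "(\<lambda>n. max (- real (Suc n)) (min (f x) (real (Suc n)))) \<longlonglongrightarrow> f x"
    by (intro tendsto_eventually) (auto simp: eventually_sequentially)
qed

lemma powr_le_split:
  fixes d \<delta> p q :: real
  assumes "0 \<le> d" "0 < \<delta>" "0 < p" "p \<le> q"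
  shows "d powr p \<le> \<delta> powr (p - q) * d powr q + \<delta> powr p"
proof (cases "d \<le> \<delta>")
  case True
  then have "d powr p \<le> \<delta> powr p" using assms by (intro powr_mono2) auto
  then show ?thesis by (simp add: add_increasing)
next
  case False
  then have "0 < d" using assms by simp
  have "d powr p = d powr (p - q) * d powr q" using \<open>0 < d\<close> by (simp add: powr_add[symmetric])
  also have "\<dots> \<le> \<delta> powr (p - q) * d powr q"
    using False assms by (intro mult_right_mono powr_mono2') auto
  finally show ?thesis by (simp add: add_increasing2)
qed

section \<open>Comparison of Besov spaces across exponents\<close>

locale conservative_dirichlet_space =
  form: symmetric_dirichlet_form M F E + semigroup: markovian_semigroup M P
  for M :: "'a::topological_space measure" and F E P +
  assumes radon: "radon_measure M"
    and associated: "associated_semigroup M F E P"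
    and conservative: "conservative M P"
    and irreducible: "irreducible_form M F E"
begin

lemma operator: "0 < t \<Longrightarrow> conservative_operator M (P t)"
  using conservative_operator_semigroup[OF radon semigroup.markovian_semigroup_axioms conservative] by simp

lemma increment_integral_energy:
  "f \<in> Lp M 2 \<Longrightarrow> 0 < t \<Longrightarrow> increment_integral M (P t) 2 f = ennreal (2 * semigroup.energy t f)"
  using conservative_operator.increment_integral_2[OF operator] by (simp add: semigroup.energy_def)

lemma besov_uminus:
  assumes "f \<in> besov_space M P p \<alpha>" "1 \<le> p"
  shows "(\<lambda>x. - f x) \<in> besov_space M P p \<alpha>"
proof -
  have f: "f \<in> Lp M p" and
    "\<exists>C\<ge>0. \<forall>t>0. increment_integral M (P t) p f \<le> ennreal (C * t powr (p * \<alpha>))"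
    using assms besov_space_iff[OF assms(2)] by blast+
  then obtain C where C: "0 \<le> C"
    "\<And>t. 0 < t \<Longrightarrow> increment_integral M (P t) p f \<le> ennreal (C * t powr (p * \<alpha>))" by blast
  have nf: "(\<lambda>x. - f x) \<in> Lp M p" using f by (simp add: Lp_def)
  have "increment_integral M (P t) p (\<lambda>x. - f x) \<le> ennreal (C * t powr (p * \<alpha>))" if t: "0 < t" for t
  proof -
    have "increment_integral M (P t) p (\<lambda>x. - f x) \<le>
        ennreal 1 * increment_integral M (P t) p f + ennreal (2 * 0) * (\<integral>\<^sup>+x. ennreal 0 \<partial>M)"
      by (rule conservative_operator.increment_integral_compare[OF operator[OF t] f assms(2) nf assms(2),
            where \<theta>="\<lambda>_. 0"])
        (auto intro!: continuous_intros L2_zero simp: abs_minus_commute)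
    then show ?thesis using C(2)[OF t] by simp
  qed
  then show ?thesis using besov_space_iff[OF assms(2)] nf C(1) by blast
qed

text \<open>
  With \<open>\<delta> = t\<^sup>\<alpha>\<close>, the pointwise bound \<open>d\<^sup>p \<le> \<delta>\<^sup>p\<^sup>-\<^sup>q d\<^sup>q + \<delta>\<^sup>p\<close> takes the place of Hoelder's inequality:
  increments of \<open>(f - c)\<^sup>+\<close> vanish unless one of the two points lies in the set \<open>f > c\<close>,
  which has finite measure.
\<close>

lemma besov_excess:
  assumes f: "f \<in> besov_space M P q \<alpha>" and pq: "1 \<le> p" "p \<le> q" and c: "0 < c"
  shows "(\<lambda>x. max (f x - c) 0) \<in> besov_space M P p \<alpha>"
proof -
  have q: "1 \<le> q" using pq by simp
  have fL: "f \<in> Lp M q" and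
    "\<exists>C\<ge>0. \<forall>t>0. increment_integral M (P t) q f \<le> ennreal (C * t powr (q * \<alpha>))"
    using f besov_space_iff[OF q] by blast+
  then obtain C where C: "0 \<le> C"
    "\<And>t. 0 < t \<Longrightarrow> increment_integral M (P t) q f \<le> ennreal (C * t powr (q * \<alpha>))" by blast
  have [measurable]: "f \<in> borel_measurable M" by (rule Lp_measurable[OF fL])
  define \<phi> where "\<phi> s = max (s - c) 0" for s :: real
  \<comment> \<open>A continuous cutoff, equal to 1 above \<open>c\<close> and to 0 below
    \<open>c / 2\<close>. The indicator of \<open>s > c\<close> would bound the increments as well,
    but \<open>increment_integral_compare\<close> asks for continuity.\<close>
  define \<theta> where "\<theta> s = min 1 (max 0 (2 * s / c - 1))" for s :: real
  have \<theta>: "0 \<le> \<theta> s" "\<theta> s \<le> 1" for s by (auto simp: \<theta>_def)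
  have gL: "(\<lambda>x. \<phi> (f x)) \<in> Lp M p"
  proof -
    have "integrable M (\<lambda>x. \<bar>\<phi> (f x)\<bar> powr p)"
    proof (rule Bochner_Integration.integrable_bound)
      show "integrable M (\<lambda>x. (c powr (p - q)) * \<bar>f x\<bar> powr q)"
        using fL by (simp add: Lp_def)
      have "\<bar>\<phi> s\<bar> powr p \<le> c powr (p - q) * \<bar>s\<bar> powr q" for s
      proof (cases "c < s")
        case True
        have "\<bar>\<phi> s\<bar> powr p \<le> s powr p" using True c pq by (intro powr_mono2) (auto simp: \<phi>_def)
        also have "\<dots> = s powr (p - q) * s powr q" using True c by (simp add: powr_add[symmetric])
        also have "\<dots> \<le> c powr (p - q) * s powr q"
          using True c pq by (intro mult_right_mono powr_mono2') auto
        finally show ?thesis using True c by simp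
      qed (simp add: \<phi>_def)
      then show "AE x in M. norm (\<bar>\<phi> (f x)\<bar> powr p) \<le> norm ((c powr (p - q)) * \<bar>f x\<bar> powr q)"
        by simp
    qed (simp add: \<phi>_def)
    then show ?thesis by (simp add: Lp_def \<phi>_def)
  qed
  let ?A = "{x\<in>space M. \<bar>f x\<bar> \<ge> c / 2}"
  have A: "emeasure M ?A < \<infinity>" using c q by (intro Lp_superlevel_finite[OF fL]) auto
  have \<theta>A: "\<theta> (f x) \<le> indicator ?A x" if "x \<in> space M" for x
  proof (cases "c / 2 \<le> \<bar>f x\<bar>")
    case False
    then have "2 * f x / c - 1 \<le> 0" using c by (simp add: field_simps)
    then show ?thesis by (simp add: \<theta>_def)
  qed (use \<theta>(2) that in simp)
  have \<theta>L: "(\<lambda>x. \<theta> (f x)) \<in> Lp M 2"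
  proof (rule L2_bounded_on_finite[OF _ A])
    show "\<bar>\<theta> (f x)\<bar> \<le> 1 * indicator ?A x" if "x \<in> space M" for x
      using \<theta>A[OF that] \<theta>(1) by simp
  qed (simp_all add: \<theta>_def)
  have "(\<integral>\<^sup>+x. ennreal (\<theta> (f x)) \<partial>M) \<le> (\<integral>\<^sup>+x. indicator ?A x \<partial>M)"
    using \<theta>A by (intro nn_integral_mono) (simp add: ennreal_indicator[symmetric] ennreal_leI del: ennreal_indicator)
  then have "(\<integral>\<^sup>+x. ennreal (\<theta> (f x)) \<partial>M) < \<infinity>"
    using A by (simp add: le_less_trans)
  then obtain k where k: "(\<integral>\<^sup>+x. ennreal (\<theta> (f x)) \<partial>M) = ennreal k" "0 \<le> k"
    by (cases "\<integral>\<^sup>+x. ennreal (\<theta> (f x)) \<partial>M") auto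
  have "increment_integral M (P t) p (\<lambda>x. \<phi> (f x)) \<le> ennreal ((C + 2 * k) * t powr (p * \<alpha>))" if t: "0 < t" for t
  proof -
    \<comment> \<open>This choice balances the two terms: both become multiples of
      \<open>t powr (p * \<alpha>)\<close>.\<close>
    define \<delta> where "\<delta> = t powr \<alpha>"
    have \<delta>: "0 < \<delta>" using t by (simp add: \<delta>_def)
    have bound: "\<bar>\<phi> s - \<phi> r\<bar> powr p \<le> \<delta> powr (p - q) * \<bar>s - r\<bar> powr q + \<delta> powr p * (\<theta> s + \<theta> r)" for s r
    proof (cases "s \<le> c \<and> r \<le> c")
      case True
      then have "\<phi> s - \<phi> r = 0" by (simp add: \<phi>_def)
      then show ?thesis using \<theta>(1)[of s] \<theta>(1)[of r] by simp
    next
      case False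
      have one: "\<theta> x = 1" if "c < x" for x
      proof -
        have "1 \<le> 2 * x / c - 1" using that c by (simp add: field_simps)
        then show ?thesis by (simp add: \<theta>_def)
      qed
      have "\<theta> s = 1 \<or> \<theta> r = 1" using False one not_le by blast
      then have \<theta>1: "1 \<le> \<theta> s + \<theta> r" using \<theta>(1)[of s] \<theta>(1)[of r] by linarith
      have "\<bar>\<phi> s - \<phi> r\<bar> \<le> \<bar>s - r\<bar>" by (auto simp: \<phi>_def max_def)
      then have "\<bar>\<phi> s - \<phi> r\<bar> powr p \<le> \<bar>s - r\<bar> powr p" using pq by (intro powr_mono2) auto
      also have "\<dots> \<le> \<delta> powr (p - q) * \<bar>s - r\<bar> powr q + \<delta> powr p * 1"
        using powr_le_split[OF _ \<delta>, of "\<bar>s - r\<bar>" p q] pq by simp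
      also have "\<dots> \<le> \<delta> powr (p - q) * \<bar>s - r\<bar> powr q + \<delta> powr p * (\<theta> s + \<theta> r)"
        using \<theta>1 by (intro add_left_mono mult_left_mono) auto
      finally show ?thesis .
    qed
    have "increment_integral M (P t) p (\<lambda>x. \<phi> (f x)) \<le> ennreal (\<delta> powr (p - q)) * increment_integral M (P t) q f +
        ennreal (2 * \<delta> powr p) * (\<integral>\<^sup>+x. ennreal (\<theta> (f x)) \<partial>M)"
    proof (rule conservative_operator.increment_integral_compare[OF operator[OF t] fL q gL pq(1) _ _ \<theta>L \<theta>(1) _ _ bound])
      show "continuous_on UNIV \<phi>" unfolding \<phi>_def by (intro continuous_intros)
      show "continuous_on UNIV \<theta>" unfolding \<theta>_def using c by (intro continuous_intros) auto
    qed auto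
    also have "\<dots> \<le> ennreal (\<delta> powr (p - q)) * ennreal (C * t powr (q * \<alpha>)) + ennreal (2 * \<delta> powr p) * ennreal k"
      unfolding k(1) by (intro add_right_mono mult_left_mono C(2)[OF t]) simp
    also have "\<dots> = ennreal (\<delta> powr (p - q) * (C * t powr (q * \<alpha>)) + 2 * \<delta> powr p * k)"
      using C(1) k(2) by (simp add: ennreal_mult[symmetric] ennreal_plus[symmetric] del: ennreal_plus)
    also have "\<delta> powr (p - q) * (C * t powr (q * \<alpha>)) = C * t powr (p * \<alpha>)"
    proof -
      have "\<delta> powr (p - q) * t powr (q * \<alpha>) = t powr (\<alpha> * (p - q) + q * \<alpha>)"
        by (simp add: \<delta>_def powr_powr powr_add)
      also have "\<alpha> * (p - q) + q * \<alpha> = p * \<alpha>" by (simp add: algebra_simps)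
      finally show ?thesis by simp
    qed
    also have "\<delta> powr p = t powr (p * \<alpha>)" by (simp add: \<delta>_def powr_powr mult.commute)
    finally show ?thesis by (simp add: algebra_simps)
  qed
  moreover have "0 \<le> C + 2 * k" using C(1) k(2) by simp
  ultimately show ?thesis
    using besov_space_iff[OF pq(1)] gL unfolding \<phi>_def by blast
qed

lemma besov_trivial_mono:
  assumes "1 \<le> p" "p \<le> q" and triv: "besov_trivial M P p \<alpha>"
  shows "besov_trivial M P q \<alpha>"
  unfolding besov_trivial_def
proof
  fix f assume f: "f \<in> besov_space M P q \<alpha>"
  have q: "1 \<le> q" using assms by simp
  show "ae_constant M f"
  proof (rule ae_constant_if_excesses_constant)
    fix n
    have "0 < 1 / real (Suc n)" by simp
    then show "ae_constant M (\<lambda>x. max (f x - 1 / real (Suc n)) 0)"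
      "ae_constant M (\<lambda>x. max (- f x - 1 / real (Suc n)) 0)"
      using triv besov_excess[OF f assms(1,2)] besov_excess[OF besov_uminus[OF f q] assms(1,2)]
      unfolding besov_trivial_def by blast+
  qed
qed

text \<open>Increments \<open>d\<close> of the truncation are at most \<open>2 * N\<close>, so
  \<open>d\<^sup>2 \<le> (2 * N) powr (2 - p) * d powr p\<close>. The increment integral keeps its
  order \<open>t powr (p * \<alpha>)\<close>, which at exponent 2 is the order of smoothness
  \<open>p * \<alpha> / 2\<close>.\<close>

lemma besov_truncation:
  assumes f: "f \<in> besov_space M P p \<alpha>" and p: "1 \<le> p" "p \<le> 2" and N: "0 < N"
  shows "(\<lambda>x. max (- N) (min (f x) N)) \<in> besov_space M P 2 (p * \<alpha> / 2)"
proof -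
  have fL: "f \<in> Lp M p" and
    "\<exists>C\<ge>0. \<forall>t>0. increment_integral M (P t) p f \<le> ennreal (C * t powr (p * \<alpha>))"
    using f besov_space_iff[OF p(1)] by blast+
  then obtain C where C: "0 \<le> C"
    "\<And>t. 0 < t \<Longrightarrow> increment_integral M (P t) p f \<le> ennreal (C * t powr (p * \<alpha>))" by blast
  have [measurable]: "f \<in> borel_measurable M" by (rule Lp_measurable[OF fL])
  define \<phi> where "\<phi> s = max (- N) (min s N)" for s :: real
  have interp: "d powr 2 \<le> K powr (2 - p) * e powr p" if "0 \<le> d" "d \<le> K" "d \<le> e" for d e K :: real
  proof -
    have "d powr 2 = d powr (2 - p) * d powr p" by (simp add: powr_add[symmetric] del: powr_numeral)
    also have "\<dots> \<le> K powr (2 - p) * e powr p"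
      using that p by (intro mult_mono powr_mono2) auto
    finally show ?thesis .
  qed
  have gL: "(\<lambda>x. \<phi> (f x)) \<in> Lp M 2"
  proof -
    have "integrable M (\<lambda>x. \<bar>\<phi> (f x)\<bar> powr 2)"
    proof (rule Bochner_Integration.integrable_bound)
      show "integrable M (\<lambda>x. (N powr (2 - p)) * \<bar>f x\<bar> powr p)"
        using fL by (simp add: Lp_def)
      have "\<bar>\<phi> s\<bar> powr 2 \<le> N powr (2 - p) * \<bar>s\<bar> powr p" for s
        using N by (intro interp) (auto simp: \<phi>_def max_def min_def)
      then show "AE x in M. norm (\<bar>\<phi> (f x)\<bar> powr 2) \<le> norm ((N powr (2 - p)) * \<bar>f x\<bar> powr p)"
        by (simp del: powr_numeral)
    qed (simp add: \<phi>_def)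
    then show ?thesis by (simp add: Lp_def \<phi>_def)
  qed
  have bound: "\<bar>\<phi> s - \<phi> r\<bar> powr 2 \<le> (2 * N) powr (2 - p) * \<bar>s - r\<bar> powr p + 0 * (0 + 0)" for s r
  proof -
    have "\<bar>\<phi> s - \<phi> r\<bar> \<le> 2 * N" "\<bar>\<phi> s - \<phi> r\<bar> \<le> \<bar>s - r\<bar>"
      using N by (auto simp: \<phi>_def max_def min_def)
    from interp[OF abs_ge_zero this] show ?thesis by (simp del: powr_numeral)
  qed
  have "increment_integral M (P t) 2 (\<lambda>x. \<phi> (f x)) \<le> ennreal (((2 * N) powr (2 - p) * C) * t powr (2 * (p * \<alpha> / 2)))"
    if t: "0 < t" for t
  proof -
    have "increment_integral M (P t) 2 (\<lambda>x. \<phi> (f x)) \<le> ennreal ((2 * N) powr (2 - p)) * increment_integral M (P t) p f +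
        ennreal (2 * 0) * (\<integral>\<^sup>+x. ennreal 0 \<partial>M)"
    proof (rule conservative_operator.increment_integral_compare[OF operator[OF t] fL p(1) gL _ _ _ _ _ _ _ bound])
      show "continuous_on UNIV \<phi>" unfolding \<phi>_def by (intro continuous_intros)
    qed (auto intro: L2_zero)
    also have "\<dots> \<le> ennreal ((2 * N) powr (2 - p)) * ennreal (C * t powr (p * \<alpha>))"
      using C(2)[OF t] by (simp add: mult_left_mono)
    also have "\<dots> = ennreal (((2 * N) powr (2 - p) * C) * t powr (2 * (p * \<alpha> / 2)))"
      using C(1) by (simp add: ennreal_mult[symmetric] mult.assoc)
    finally show ?thesis .
  qed
  moreover have "0 \<le> (2 * N) powr (2 - p) * C" using C(1) by simp
  ultimately show ?thesis
    using besov_space_iff[OF one_le_numeral] gL unfolding \<phi>_def by blast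
qed

lemma besov_trivial_2:
  assumes \<alpha>: "1 / 2 < \<alpha>"
  shows "besov_trivial M P 2 \<alpha>"
  unfolding besov_trivial_def
proof
  fix f assume "f \<in> besov_space M P 2 \<alpha>"
  then have f: "f \<in> Lp M 2" and
    "\<exists>C\<ge>0. \<forall>t>0. increment_integral M (P t) 2 f \<le> ennreal (C * t powr (2 * \<alpha>))"
    using besov_space_iff[OF one_le_numeral] by blast+
  then obtain C where C: "0 \<le> C"
    "\<And>t. 0 < t \<Longrightarrow> increment_integral M (P t) 2 f \<le> ennreal (C * t powr (2 * \<alpha>))" by blast
  have "semigroup.energy t f \<le> C * t powr (2 * \<alpha>)" if t: "0 < t" for t
  proof -
    have "ennreal (2 * semigroup.energy t f) \<le> ennreal (C * t powr (2 * \<alpha>))"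
      using C(2)[OF t] increment_integral_energy[OF f t] by simp
    then have "2 * semigroup.energy t f \<le> C * t powr (2 * \<alpha>)"
      using C(1) by (subst (asm) ennreal_le_iff) auto
    then show ?thesis using semigroup.energy_nonneg[OF f, of t] t by simp
  qed
  then have fixed: "AE x in M. P t f x = f x" if "0 < t" for t
    using \<alpha> that by (intro semigroup.fixed_if_energy_superlinear[OF f, of "2 * \<alpha>"]) auto
  \<comment> \<open>The difference quotients of a fixed function vanish, so it lies in the domain of
    the generator with image 0. The link between generator and form then gives
    \<open>E f f = 0\<close>.\<close>
  have "L2_norm M (\<lambda>x. (P t f x - f x) / t - 0) = 0" if "0 < t" for t
  proof -
    have "L2_inner M (\<lambda>x. (P t f x - f x) / t - 0) (\<lambda>x. (P t f x - f x) / t - 0) = 0"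
      unfolding L2_inner_def using fixed[OF that] by (intro integral_eq_zero_AE) (auto elim: eventually_mono)
    then show ?thesis by (simp add: L2_norm_def)
  qed
  then have "\<forall>\<^sub>F t in at_right 0. L2_norm M (\<lambda>x. (P t f x - f x) / t - 0) = 0"
    by (intro eventually_at_right_less[THEN eventually_mono]) 
  then have "((\<lambda>t. L2_norm M (\<lambda>x. (P t f x - f x) / t - 0)) \<longlongrightarrow> 0) (at_right 0)"
    by (rule tendsto_eventually)
  then have *: "f \<in> F \<and> (\<forall>v\<in>F. E f v = - L2_inner M (\<lambda>x. 0) v)"
    using associated f L2_zero unfolding associated_semigroup_def by blast
  then have "E f f = 0" by (simp add: L2_inner_def)
  then show "ae_constant M f" using irreducible * unfolding irreducible_form_def by blast
qed

text \<open>A nonconstant resolvent lies in the domain of the generator, where the energy grows at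
  most linearly. For \<open>\<alpha> \<le> 1 / 2\<close> this is enough regularity.\<close>

lemma not_besov_trivial_2:
  assumes nondeg: "\<exists>f\<in>Lp M 2. \<not> ae_constant M f" and \<alpha>: "0 < \<alpha>" "\<alpha> \<le> 1 / 2"
  shows "\<not> besov_trivial M P 2 \<alpha>"
proof -
  obtain u h where u: "u \<in> F" "h \<in> Lp M 2" "\<not> ae_constant M u" "\<And>v. v \<in> F \<Longrightarrow> form.form1 u v = L2_inner M h v"
    using form.nonconstant_resolvent nondeg by blast
  have uL: "u \<in> Lp M 2" by (rule form.domain_in_L2[OF u(1)])
  \<comment> \<open>The image of \<open>u\<close> under the generator: \<open>E u v\<close> is
    \<open>form1 u v - L2_inner M u v\<close>, that is, the pairing of \<open>h - u\<close> with
    \<open>v\<close>.\<close>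
  define w where "w x = u x - h x" for x
  have w: "w \<in> Lp M 2" unfolding w_def by (rule L2_diff[OF uL u(2)])
  have "E u v = - L2_inner M w v" if "v \<in> F" for v
    using u(4)[OF that] L2_form.Q_diff[OF uL u(2) form.domain_in_L2[OF that]]
    by (simp add: form.form1_def w_def[abs_def])
  then have "((\<lambda>t. L2_norm M (\<lambda>x. (P t u x - u x) / t - w x)) \<longlongrightarrow> 0) (at_right 0)"
    using associated uL w u(1) unfolding associated_semigroup_def by blast
  from semigroup.energy_linear[OF uL w this]
  obtain C where C: "0 \<le> C" "\<And>t. 0 < t \<Longrightarrow> semigroup.energy t u \<le> C * t" by blast
  define K where "K = 2 * (C + L2_inner M u u)"
  have u0: "0 \<le> L2_inner M u u" by (rule L2_form.Q_nonneg[OF uL])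
  have "increment_integral M (P t) 2 u \<le> ennreal (K * t powr (2 * \<alpha>))" if t: "0 < t" for t
  proof -
    have "semigroup.energy t u \<le> (C + L2_inner M u u) * t powr (2 * \<alpha>)"
    \<comment> \<open>For \<open>t \<le> 1\<close> the linear bound suffices because
      \<open>t \<le> t powr (2 * \<alpha>)\<close>; for larger \<open>t\<close> the energy is
      bounded by the squared norm of \<open>u\<close>. \<open>K\<close> adds the two
      constants.\<close>
    proof (cases "t \<le> 1")
      case True
      have "t = t powr 1" using t by simp
      also have "\<dots> \<le> t powr (2 * \<alpha>)" using True t \<alpha> by (intro powr_mono') auto
      finally have "C * t \<le> C * t powr (2 * \<alpha>)" using C(1) by (rule mult_left_mono)
      moreover have "0 \<le> L2_inner M u u * t powr (2 * \<alpha>)" using u0 by simp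
      ultimately show ?thesis using C(2)[OF t] by (simp add: distrib_right)
    next
      case False
      then have "1 \<le> t powr (2 * \<alpha>)" using \<alpha> by (intro ge_one_powr_ge_zero) auto
      then have "L2_inner M u u * 1 \<le> L2_inner M u u * t powr (2 * \<alpha>)" using u0 by (rule mult_left_mono)
      moreover have "0 \<le> C * t powr (2 * \<alpha>)" using C(1) by simp
      ultimately show ?thesis using semigroup.energy_le[OF uL, of t] t by (simp add: distrib_right)
    qed
    then have "2 * semigroup.energy t u \<le> K * t powr (2 * \<alpha>)"
      unfolding K_def mult.assoc by (rule mult_left_mono) simp
    then show ?thesis
      unfolding increment_integral_energy[OF uL t] by (rule ennreal_leI)
  qed
  moreover have "0 \<le> K" using C(1) u0 by (simp add: K_def)
  ultimately have "u \<in> besov_space M P 2 \<alpha>" using besov_space_iff[OF one_le_numeral] uL by blast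
  then show ?thesis using u(3) unfolding besov_trivial_def by blast
qed

lemma besov_trivial_le_2:
  assumes p: "1 \<le> p" "p \<le> 2" and \<alpha>: "1 / p < \<alpha>"
  shows "besov_trivial M P p \<alpha>"
  unfolding besov_trivial_def
proof
  fix f assume f: "f \<in> besov_space M P p \<alpha>"
  have "1 < \<alpha> * p" using p \<alpha> by (subst (asm) pos_divide_less_eq) auto
  then have "1 / 2 < p * \<alpha> / 2" by (simp add: mult.commute)
  then have triv: "besov_trivial M P 2 (p * \<alpha> / 2)" by (rule besov_trivial_2)
  show "ae_constant M f"
  proof (rule ae_constant_if_truncations_constant)
    fix n
    have "(\<lambda>x. max (- real (Suc n)) (min (f x) (real (Suc n)))) \<in> besov_space M P 2 (p * \<alpha> / 2)"
      by (rule besov_truncation[OF f p]) simp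
    with triv show "ae_constant M (\<lambda>x. max (- real (Suc n)) (min (f x) (real (Suc n))))"
      unfolding besov_trivial_def by (rule bspec)
  qed
qed

lemma critical_exponent_le:
  assumes "0 \<le> a" "\<And>\<alpha>. a < \<alpha> \<Longrightarrow> besov_trivial M P p \<alpha>"
  shows "critical_exponent M P p \<le> ereal a"
proof (rule ereal_le_epsilon2)
  fix e :: real assume "0 < e"
  then have "ereal (a + e) \<in> ereal ` {\<alpha>. 0 < \<alpha> \<and> besov_trivial M P p \<alpha>}"
    using assms by auto
  then show "critical_exponent M P p \<le> ereal a + ereal e"
    unfolding critical_exponent_def by (simp add: Inf_lower)
qed

lemma critical_exponent_antimono:
  "1 \<le> p \<Longrightarrow> p \<le> q \<Longrightarrow> critical_exponent M P q \<le> critical_exponent M P p"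
  unfolding critical_exponent_def using besov_trivial_mono by (intro Inf_superset_mono) blast

lemma critical_exponent_2:
  assumes "\<exists>f\<in>Lp M 2. \<not> ae_constant M f"
  shows "critical_exponent M P 2 = ereal (1 / 2)"
proof (rule antisym)
  show "critical_exponent M P 2 \<le> ereal (1 / 2)"
    by (rule critical_exponent_le) (auto intro: besov_trivial_2)
  show "ereal (1 / 2) \<le> critical_exponent M P 2"
    unfolding critical_exponent_def
  proof (rule Inf_greatest)
    fix x assume "x \<in> ereal ` {\<alpha>. 0 < \<alpha> \<and> besov_trivial M P 2 \<alpha>}"
    then obtain \<alpha> where \<alpha>: "x = ereal \<alpha>" "0 < \<alpha>" "besov_trivial M P 2 \<alpha>" by blast
    then have "\<not> \<alpha> \<le> 1 / 2" using not_besov_trivial_2[OF assms] by blast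
    then show "ereal (1 / 2) \<le> x" unfolding \<alpha>(1) by simp
  qed
qed

end

text \<open>If every function in \<open>Lp M 2\<close> were constant almost everywhere, as on a
  one-point space, all spaces with \<open>p = 2\<close> would be trivial and the critical exponent
  at 2 would be 0. The assumption \<open>nondegenerate\<close> excludes this case; it supports part
  (1) and, through monotonicity, the lower bound in part (4).\<close>

theorem proposition0p3:
  fixes M :: "'a::topological_space measure"
    and F :: "('a \<Rightarrow> real) set"
    and E :: "('a \<Rightarrow> real) \<Rightarrow> ('a \<Rightarrow> real) \<Rightarrow> real"
    and P :: "real \<Rightarrow> ('a \<Rightarrow> real) \<Rightarrow> ('a \<Rightarrow> real)"
  assumes "radon_measure M"
    and "symmetric_dirichlet_form M F E"
    and "markovian_semigroup M P"
    and "associated_semigroup M F E P"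
    and "conservative M P"
    and "regular_form M F E"
    and "irreducible_form M F E"
    and nondegenerate: "\<exists>f\<in>Lp M 2. \<not> ae_constant M f"
  shows "critical_exponent M P 2 = ereal (1 / 2) \<and>
    antimono_on {1..} (critical_exponent M P) \<and>
    (\<forall>p\<ge>2. critical_exponent M P p \<le> ereal (1 / 2)) \<and>
    (\<forall>p. 1 \<le> p \<and> p \<le> 2 \<longrightarrow>
       ereal (1 / 2) \<le> critical_exponent M P p \<and> critical_exponent M P p \<le> ereal (1 / p))"
proof -
  interpret conservative_dirichlet_space M F E P
    using assms by (simp add: conservative_dirichlet_space_def conservative_dirichlet_space_axioms_def)
  note two = critical_exponent_2[OF nondegenerate]
  show ?thesis
  proof (intro conjI allI impI)
    show "critical_exponent M P 2 = ereal (1 / 2)" by (rule two)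
    show "antimono_on {1..} (critical_exponent M P)"
      by (intro monotone_onI critical_exponent_antimono) auto
    show "critical_exponent M P p \<le> ereal (1 / 2)" if "2 \<le> p" for p
      using critical_exponent_antimono[of 2 p] that two by simp
    fix p :: real assume p: "1 \<le> p \<and> p \<le> 2"
    show "ereal (1 / 2) \<le> critical_exponent M P p"
      using critical_exponent_antimono[of p 2] p two by simp
    show "critical_exponent M P p \<le> ereal (1 / p)"
      using p by (intro critical_exponent_le besov_trivial_le_2) auto
  qed
qed

end
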